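(* Let $F$ be a field of characteristic zero and let $\mathbb M=M_{1,1}(F)$ be the algebra of $2\times 2$ matrices over $F$ with its canonical $\mathbb Z_2$-grading and the transpose superinvolution. Let $n\ge1$, let $\langle n\rangle=(n_1,n_2,n_3,n_4)$ be a composition of $n$ into nonnegative integers, and let $\chi_{\langle n\rangle}(\mathbb M)=\sum_{\langle\lambda\rangle\vdash\langle n\rangle}m_{\langle\lambda\rangle}\chi_{\langle\lambda\rangle}$ be the decomposition of the $\langle n\rangle$-cocharacter of $\mathbb M$ into irreducible $S_{\langle n\rangle}$-characters. If $\langle\lambda\rangle=(\lambda(1),\dots,\lambda(4))$ is such that each $\lambda(i)$ has at most one row, i.e. $\langle\lambda\rangle=((n_1),(n_2),(n_3),(n_4))$, then $$m_{\langle\lambda\rangle}=\begin{cases}2,&\text{if } n_3=n_4>0;\\ 1,&\text{if } |n_3-n_4|=1\text{ or } n_3=n_4=0;\\ 0,&\text{if } |n_3-n_4|>1,\end{cases}$$ and $m_{\langle\lambda\rangle}=0$ for all other multipartitions $\langle\lambda\rangle\vdash\langle n\rangle$.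
   Context: A superalgebra is an associative $F$-algebra $A=A^{(0)}\oplus A^{(1)}$ with $A^{(i)}A^{(j)}\subseteq A^{(i+j \bmod 2)}$; for homogeneous $a\in A^{(i)}$ write $|a|=i$. A superinvolution on $A$ is a linear map $*:A\to A$ with $(A^{(i)})^*=A^{(i)}$, $(a^* )^*=a$ for all $a$, and $(ab)^*=(-1)^{|a||b|}b^*a^*$ for homogeneous $a,b$. A superalgebra with superinvolution is called a $*$-algebra. Put $(A^{(i)})^{+}=\{a\in A^{(i)}:a^*=a\}$ and $(A^{(i)})^{-}=\{a\in A^{(i)}:a^*=-a\}$. $\mathbb M=M_{1,1}(F)$ is $M_2(F)$ with even part $\mathrm{span}\{e_{11},e_{22}\}$, odd part $\mathrm{span}\{e_{12},e_{21}\}$, and superinvolution $\begin{pmatrix}a&c\\d&b\end{pmatrix}^{*}=\begin{pmatrix}b&-c\\d&a\end{pmatrix}$. Thus $(\mathbb M^{(0)})^+=F(e_{11}+e_{22})$, $(\mathbb M^{(0)})^-=F(e_{11}-e_{22})$, $(\mathbb M^{(1)})^+=Fe_{21}$, $(\mathbb M^{(1)})^-=Fe_{12}$. Let $\mathcal F$ be the free associative algebra over $F$ on the non-commuting variables $y_{i,0},z_{i,0},y_{i,1},z_{i,1}$ ($i\ge 1$). An element $f\in\mathcal F$ is a $*$-identity of a $*$-algebra $A$ if $f$ vanishes under every substitution of the variables $y_{i,0},z_{i,0},y_{i,1},z_{i,1}$ by elements of $(A^{(0)})^+,(A^{(0)})^-,(A^{(1)})^+,(A^{(1)})^-$ respectively;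 $Id^*(A)$ is the set of $*$-identities of $A$. For $\langle n\rangle=(n_1,n_2,n_3,n_4)$ with $n=n_1+n_2+n_3+n_4$ and $n_i\ge0$, $P_{\langle n\rangle}\subset\mathcal F$ is the space of multilinear polynomials of degree $n$ in the variables $y_{1,0},\dots,y_{n_1,0}$, $z_{1,0},\dots,z_{n_2,0}$, $y_{1,1},\dots,y_{n_3,1}$, $z_{1,1},\dots,z_{n_4,1}$ (each occurring exactly once in every monomial). The group $S_{\langle n\rangle}=S_{n_1}\times S_{n_2}\times S_{n_3}\times S_{n_4}$ acts on $P_{\langle n\rangle}$ on the left by permuting the indices of the variables within each of these four groups, in this order. The space $P_{\langle n\rangle}\cap Id^*(A)$ is invariant, and the $\langle n\rangle$-cocharacter $\chi_{\langle n\rangle}(A)$ is the $S_{\langle n\rangle}$-character of $P_{\langle n\rangle}/(P_{\langle n\rangle}\cap Id^*(A))$. A multipartition $\langle\lambda\rangle\vdash\langle n\rangle$ is a 4-tuple of partitions $\lambda(i)\vdash n_i$; $\chi_{\langle\lambda\rangle}=\chi_{\lambda(1)}\otimes\cdots\otimes\chi_{\lambda(4)}$, where $\chi_{\lambda}$ is the irreducible character of the symmetric group attached to the partition $\lambda$ (with $\chi_{(m)}$ the trivial character of $S_m$), and $m_{\langle\lambda\rangle}$ is its multiplicity. *)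

theory Defs
  imports
    "HOL-Analysis.Cartesian_Space"
    "HOL-Library.Poly_Mapping"
    "HOL-Combinatorics.Permutations"
begin

section \<open>Superalgebras with superinvolution\<close>

text \<open>
  The carrier is the whole type \<open>'a\<close>, whose addition is that of its type class; the grading group
  is represented by the indices 0 and 1 with addition modulo 2. Multiplication is a field of the
  record (rather than the class operation) because the class multiplication on the matrix type
  \<open>'f^2^2\<close> is the entrywise one.
\<close>

record ('f, 'a) superinv_algebra =
  smult :: "'f \<Rightarrow> 'a \<Rightarrow> 'a"
  mult :: "'a \<Rightarrow> 'a \<Rightarrow> 'a"
  one :: "'a"
  grade :: "nat \<Rightarrow> 'a set"
  star :: "'a \<Rightarrow> 'a"

locale star_algebra = vector_space "smult A"
  for A :: "('f::field, 'a::ab_group_add) superinv_algebra" +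
  assumes mult_add_left: "mult A (a + b) c = mult A a c + mult A b c"
    and mult_add_right: "mult A a (b + c) = mult A a b + mult A a c"
    and mult_smult_left: "mult A (smult A r a) b = smult A r (mult A a b)"
    and mult_smult_right: "mult A a (smult A r b) = smult A r (mult A a b)"
    and mult_assoc: "mult A (mult A a b) c = mult A a (mult A b c)"
    and one_left: "mult A (one A) a = a"
    and one_right: "mult A a (one A) = a"
    and grade_subspace: "i < 2 \<Longrightarrow> subspace (grade A i)"
    and grade_direct_sum: "\<exists>!p. fst p \<in> grade A 0 \<and> snd p \<in> grade A 1 \<and> a = fst p + snd p"
    and grade_mult:
      "\<lbrakk>i < 2; j < 2; a \<in> grade A i; b \<in> grade A j\<rbrakk> \<Longrightarrow> mult A a b \<in> grade A ((i + j) mod 2)"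
    and star_add: "star A (a + b) = star A a + star A b"
    and star_smult: "star A (smult A r a) = smult A r (star A a)"
    and star_grade: "i < 2 \<Longrightarrow> star A ` grade A i = grade A i"
    and star_star: "star A (star A a) = a"
    and star_mult:
      "\<lbrakk>i < 2; j < 2; a \<in> grade A i; b \<in> grade A j\<rbrakk>
        \<Longrightarrow> star A (mult A a b) = smult A ((-1) ^ (i * j)) (mult A (star A b) (star A a))"

definition sym_part :: "('f, 'a::ab_group_add) superinv_algebra \<Rightarrow> nat \<Rightarrow> 'a set" where
  "sym_part A i = {a \<in> grade A i. star A a = a}"

definition skew_part :: "('f, 'a::ab_group_add) superinv_algebra \<Rightarrow> nat \<Rightarrow> 'a set" where
  "skew_part A i = {a \<in> grade A i. star A a = - a}"


section \<open>The superalgebra of 2 by 2 matrices with the transpose superinvolution\<close>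

definition M11 :: "('f::field, 'f^2^2) superinv_algebra" where
  "M11 = \<lparr>
     smult = (\<lambda>c X. \<chi> i j. c * X $ i $ j),
     mult = (\<lambda>X Y. X ** Y),
     one = mat 1,
     grade = (\<lambda>i. if i = 0 then {X. X $ 1 $ 2 = 0 \<and> X $ 2 $ 1 = 0}
                  else {X. X $ 1 $ 1 = 0 \<and> X $ 2 $ 2 = 0}),
     star = (\<lambda>X. vector [vector [X $ 2 $ 2, - (X $ 1 $ 2)],
                          vector [X $ 2 $ 1,    X $ 1 $ 1]]) \<rparr>"


section \<open>The free algebra, evaluations and star-identities\<close>

text \<open>
  The variable \<open>(Y0, i)\<close> is $y_{i,0}$, \<open>(Z0, i)\<close> is $z_{i,0}$, \<open>(Y1, i)\<close> is $y_{i,1}$ and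
  \<open>(Z1, i)\<close> is $z_{i,1}$. 4-tuples indexed by the four kinds of variables (compositions,
  multipartitions, elements of a product of four symmetric groups) are functions on \<open>vkind\<close>.
  The variables of index 0 are spare ones, not used below.
\<close>

datatype vkind = Y0 | Z0 | Y1 | Z1

lemma UNIV_vkind: "(UNIV :: vkind set) = {Y0, Z0, Y1, Z1}"
  by (auto intro: vkind.exhaust)

instance vkind :: finite
  by standard (simp add: UNIV_vkind)

type_synonym var = "vkind \<times> nat"

text \<open>
  With words forming a monoid under concatenation, the multiplication of \<open>var list \<Rightarrow>\<^sub>0 'f\<close>
  provided by the library is that of the free associative algebra.
\<close>

instantiation list :: (type) monoid_add
begin

definition zero_list :: "'a list" where "zero_list = []"

definition plus_list :: "'a list \<Rightarrow> 'a list \<Rightarrow> 'a list" where "plus_list = (@)"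

instance
  by standard (simp_all add: zero_list_def plus_list_def)

end

type_synonym 'f free_algebra = "var list \<Rightarrow>\<^sub>0 'f"

definition pm_scale :: "'f::field \<Rightarrow> ('k \<Rightarrow>\<^sub>0 'f) \<Rightarrow> ('k \<Rightarrow>\<^sub>0 'f)" where
  "pm_scale c f = Poly_Mapping.map ((*) c) f"

definition pm_extend :: "('k \<Rightarrow> 'l) \<Rightarrow> ('k \<Rightarrow>\<^sub>0 'f::field) \<Rightarrow> ('l \<Rightarrow>\<^sub>0 'f)"
  \<comment> \<open>the linear extension of a map between basis elements\<close>
  where "pm_extend h f = (\<Sum>k\<in>Poly_Mapping.keys f. Poly_Mapping.single (h k) (Poly_Mapping.lookup f k))"

definition eval_word :: "('f, 'a) superinv_algebra \<Rightarrow> (var \<Rightarrow> 'a) \<Rightarrow> var list \<Rightarrow> 'a" where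
  "eval_word A \<phi> w = foldr (\<lambda>v a. mult A (\<phi> v) a) w (one A)"

definition eval_poly ::
  "('f::field, 'a::ab_group_add) superinv_algebra \<Rightarrow> (var \<Rightarrow> 'a) \<Rightarrow> 'f free_algebra \<Rightarrow> 'a" where
  "eval_poly A \<phi> f =
     (\<Sum>w\<in>Poly_Mapping.keys f. smult A (Poly_Mapping.lookup f w) (eval_word A \<phi> w))"

fun component :: "('f, 'a::ab_group_add) superinv_algebra \<Rightarrow> vkind \<Rightarrow> 'a set" where
  "component A Y0 = sym_part A 0"
| "component A Z0 = skew_part A 0"
| "component A Y1 = sym_part A 1"
| "component A Z1 = skew_part A 1"

definition Id_star ::
  "('f::field, 'a::ab_group_add) superinv_algebra \<Rightarrow> 'f free_algebra set" where
  "Id_star A = {f. \<forall>\<phi>. (\<forall>s i. \<phi> (s, i) \<in> component A s) \<longrightarrow> eval_poly A \<phi> f = 0}"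

definition multilinear :: "(vkind \<Rightarrow> nat) \<Rightarrow> 'f::field free_algebra set" where
  "multilinear ns =
     {f. \<forall>w\<in>Poly_Mapping.keys f. distinct w \<and> set w = {(s, i). 1 \<le> i \<and> i \<le> ns s}}"


section \<open>Cocharacters\<close>

text \<open>
  \<open>is_quot_basis sc V W B\<close> says that \<open>B\<close> maps bijectively to a (finite) basis of the quotient of
  \<open>V\<close> by its subspace \<open>W\<close>. The trace of the endomorphism of that quotient induced by \<open>f\<close> (which
  must map \<open>V\<close> and \<open>W\<close> into themselves) does not depend on the choice of \<open>B\<close>.
\<close>

definition is_quot_coord ::
  "('f::field \<Rightarrow> 'v::ab_group_add \<Rightarrow> 'v) \<Rightarrow> 'v set \<Rightarrow> 'v set \<Rightarrow> 'v \<Rightarrow> ('v \<Rightarrow> 'f) \<Rightarrow> bool"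
  where
  "is_quot_coord sc W B v c \<longleftrightarrow>
     (\<forall>b. b \<notin> B \<longrightarrow> c b = 0) \<and> v - (\<Sum>b\<in>B. sc (c b) b) \<in> W"

definition is_quot_basis ::
  "('f::field \<Rightarrow> 'v::ab_group_add \<Rightarrow> 'v) \<Rightarrow> 'v set \<Rightarrow> 'v set \<Rightarrow> 'v set \<Rightarrow> bool"
  where
  "is_quot_basis sc V W B \<longleftrightarrow>
     finite B \<and> B \<subseteq> V \<and> (\<forall>v\<in>V. \<exists>!c. is_quot_coord sc W B v c)"

definition quot_trace ::
  "('f::field \<Rightarrow> 'v::ab_group_add \<Rightarrow> 'v) \<Rightarrow> 'v set \<Rightarrow> 'v set \<Rightarrow> ('v \<Rightarrow> 'v) \<Rightarrow> 'f"
  where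
  "quot_trace sc V W f =
     (let B = (SOME B. is_quot_basis sc V W B)
      in \<Sum>b\<in>B. (THE c. is_quot_coord sc W B (f b) c) b)"

definition sym_groups :: "(vkind \<Rightarrow> nat) \<Rightarrow> (vkind \<Rightarrow> nat \<Rightarrow> nat) set" where
  "sym_groups ns = {\<sigma>. \<forall>s. \<sigma> s permutes {1..ns s}}"

definition var_action :: "(vkind \<Rightarrow> nat \<Rightarrow> nat) \<Rightarrow> 'f::field free_algebra \<Rightarrow> 'f free_algebra" where
  "var_action \<sigma> = pm_extend (map (\<lambda>(s, i). (s, \<sigma> s i)))"

definition cocharacter ::
  "('f::field, 'a::ab_group_add) superinv_algebra \<Rightarrow> (vkind \<Rightarrow> nat) \<Rightarrow> (vkind \<Rightarrow> nat \<Rightarrow> nat) \<Rightarrow> 'f"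
  where
  "cocharacter A ns \<sigma> =
     quot_trace pm_scale (multilinear ns) (multilinear ns \<inter> Id_star A) (var_action \<sigma>)"


section \<open>Irreducible characters of the symmetric groups\<close>

definition partition_of :: "nat \<Rightarrow> nat list \<Rightarrow> bool" where
  "partition_of m \<mu> \<longleftrightarrow> sorted_wrt (\<ge>) \<mu> \<and> (\<forall>k\<in>set \<mu>. 0 < k) \<and> sum_list \<mu> = m"

text \<open>
  The canonical tableau of shape \<open>\<mu>\<close>, with its boxes numbered 1, 2, 3, ... along the rows; rows
  and columns are counted from 0.
\<close>

definition tableau :: "nat list \<Rightarrow> nat \<Rightarrow> nat \<Rightarrow> nat" where
  "tableau \<mu> r c = sum_list (take r \<mu>) + c + 1"

definition row_entries :: "nat list \<Rightarrow> nat \<Rightarrow> nat set" where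
  "row_entries \<mu> r = {tableau \<mu> r c |c. r < length \<mu> \<and> c < \<mu> ! r}"

definition col_entries :: "nat list \<Rightarrow> nat \<Rightarrow> nat set" where
  "col_entries \<mu> c = {tableau \<mu> r c |r. r < length \<mu> \<and> c < \<mu> ! r}"

definition row_group :: "nat list \<Rightarrow> (nat \<Rightarrow> nat) set" where
  "row_group \<mu> = {p. p permutes {1..sum_list \<mu>} \<and> (\<forall>r. p ` row_entries \<mu> r = row_entries \<mu> r)}"

definition col_group :: "nat list \<Rightarrow> (nat \<Rightarrow> nat) set" where
  "col_group \<mu> = {p. p permutes {1..sum_list \<mu>} \<and> (\<forall>c. p ` col_entries \<mu> c = col_entries \<mu> c)}"

text \<open>
  The group algebra of $S_m$ consists of the elements of \<open>(nat \<Rightarrow> nat) \<Rightarrow>\<^sub>0 'f\<close> supported on the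
  permutations of \<open>{1..m}\<close>. The irreducible module attached to \<open>\<mu>\<close> is the left ideal generated by
  the Young symmetrizer.
\<close>

definition young_symmetrizer :: "nat list \<Rightarrow> (nat \<Rightarrow> nat) \<Rightarrow>\<^sub>0 'f::field" where
  "young_symmetrizer \<mu> =
     (\<Sum>p\<in>row_group \<mu>. \<Sum>q\<in>col_group \<mu>. Poly_Mapping.single (p \<circ> q) (of_int (sign q)))"

definition left_mult :: "(nat \<Rightarrow> nat) \<Rightarrow> ((nat \<Rightarrow> nat) \<Rightarrow>\<^sub>0 'f::field) \<Rightarrow> ((nat \<Rightarrow> nat) \<Rightarrow>\<^sub>0 'f)" where
  "left_mult p = pm_extend ((\<circ>) p)"

definition specht_module :: "nat list \<Rightarrow> ((nat \<Rightarrow> nat) \<Rightarrow>\<^sub>0 'f::field) set" where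
  "specht_module \<mu> =
     module.span pm_scale {left_mult p (young_symmetrizer \<mu>) |p. p permutes {1..sum_list \<mu>}}"

definition irr_char :: "nat list \<Rightarrow> (nat \<Rightarrow> nat) \<Rightarrow> 'f::field" where
  "irr_char \<mu> p = quot_trace pm_scale (specht_module \<mu>) {0} (left_mult p)"

definition multipartitions :: "(vkind \<Rightarrow> nat) \<Rightarrow> (vkind \<Rightarrow> nat list) set" where
  "multipartitions ns = {\<Lambda>. \<forall>s. partition_of (ns s) (\<Lambda> s)}"

definition irr_multichar :: "(vkind \<Rightarrow> nat list) \<Rightarrow> (vkind \<Rightarrow> nat \<Rightarrow> nat) \<Rightarrow> 'f::field" where
  "irr_multichar \<Lambda> \<sigma> = (\<Prod>s\<in>UNIV. irr_char (\<Lambda> s) (\<sigma> s))"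

definition is_cocharacter_decomposition ::
  "('f::field, 'a::ab_group_add) superinv_algebra \<Rightarrow> (vkind \<Rightarrow> nat) \<Rightarrow> ((vkind \<Rightarrow> nat list) \<Rightarrow> nat) \<Rightarrow> bool"
  where
  "is_cocharacter_decomposition A ns m \<longleftrightarrow>
     (\<forall>\<sigma>\<in>sym_groups ns.
        cocharacter A ns \<sigma> = (\<Sum>\<Lambda>\<in>multipartitions ns. of_nat (m \<Lambda>) * irr_multichar \<Lambda> \<sigma>))"


section \<open>Basic facts\<close>

lemma vector_space_pm_scale: "vector_space (pm_scale :: 'f::field \<Rightarrow> ('k \<Rightarrow>\<^sub>0 'f) \<Rightarrow> _)"
proof -
  have l: "Poly_Mapping.lookup (pm_scale c f) k = c * Poly_Mapping.lookup f k" for c :: 'f and f and k :: 'k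
    by (simp add: pm_scale_def Poly_Mapping.map.rep_eq when_def)
  show ?thesis
    by unfold_locales (auto intro!: poly_mapping_eqI simp: l lookup_add algebra_simps)
qed

lemma finite_partitions: "finite {\<mu>. partition_of m \<mu>}"
proof (rule finite_subset)
  show "{\<mu>. partition_of m \<mu>} \<subseteq> {\<mu>. set \<mu> \<subseteq> {..m} \<and> length \<mu> \<le> m}"
  proof (rule subsetI)
    fix \<mu> assume "\<mu> \<in> {\<mu>. partition_of m \<mu>}"
    then have pos: "\<forall>k\<in>set \<mu>. 0 < k" and s: "sum_list \<mu> = m"
      by (auto simp: partition_of_def)
    have "length \<mu> \<le> sum_list \<mu>"
      using pos by (induction \<mu>) (auto simp: Suc_le_eq)
    then show "\<mu> \<in> {\<mu>. set \<mu> \<subseteq> {..m} \<and> length \<mu> \<le> m}"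
      using s member_le_sum_list by auto
  qed
  show "finite {\<mu>. set \<mu> \<subseteq> {..m} \<and> length \<mu> \<le> m}"
    by (rule finite_lists_length_le) simp
qed

lemma finite_multipartitions: "finite (multipartitions ns)"
proof -
  have "multipartitions ns = (\<Pi>\<^sub>E s\<in>UNIV. {\<mu>. partition_of (ns s) \<mu>})"
    by (auto simp: multipartitions_def PiE_def)
  then show ?thesis
    by (simp add: finite_PiE finite_partitions)
qed

lemma star_algebra_M11: "star_algebra (M11 :: ('f::field, 'f^2^2) superinv_algebra)"
proof -
  note s = M11_def vec_eq_iff forall_2 matrix_matrix_mult_def sum_2 vector_2 mat_def
  interpret vector_space "smult (M11 :: ('f, 'f^2^2) superinv_algebra)"
    by unfold_locales (simp_all add: s algebra_simps)
  have less2: "i = 0 \<or> i = 1" if "i < 2" for i :: nat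
    using that by linarith
  show ?thesis
  proof
    fix i :: nat assume "i < 2"
    show "subspace (grade (M11 :: ('f, 'f^2^2) superinv_algebra) i)"
      unfolding subspace_def by (auto simp: s)
    show "star M11 ` grade (M11 :: ('f, 'f^2^2) superinv_algebra) i = grade M11 i"
    proof (intro equalityI subsetI)
      fix X :: "'f^2^2" assume "X \<in> star M11 ` grade M11 i"
      then show "X \<in> grade M11 i" by (auto simp: s split: if_splits)
    next
      fix X :: "'f^2^2" assume "X \<in> grade M11 i"
      then have "star M11 X \<in> grade M11 i" "X = star M11 (star M11 X)"
        by (auto simp: s split: if_splits)
      then show "X \<in> star M11 ` grade M11 i" by blast
    qed
  next
    fix a :: "'f^2^2"
    show "\<exists>!p. fst p \<in> grade M11 0 \<and> snd p \<in> grade M11 1 \<and> a = fst p + snd p"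
    proof (rule ex1I)
      let ?p = "(vector [vector [a $ 1 $ 1, 0], vector [0, a $ 2 $ 2]] :: 'f^2^2,
                 vector [vector [0, a $ 1 $ 2], vector [a $ 2 $ 1, 0]] :: 'f^2^2)"
      show "fst ?p \<in> grade M11 0 \<and> snd ?p \<in> grade M11 1 \<and> a = fst ?p + snd ?p"
        by (simp add: s)
      fix p :: "('f^2^2) \<times> ('f^2^2)"
      assume "fst p \<in> grade M11 0 \<and> snd p \<in> grade M11 1 \<and> a = fst p + snd p"
      then show "p = ?p" by (simp add: s prod_eq_iff)
    qed
  next
    fix i j :: nat and a b :: "'f^2^2"
    assume "i < 2" "j < 2" "a \<in> grade M11 i" "b \<in> grade M11 j"
    then show "mult M11 a b \<in> grade M11 ((i + j) mod 2)"
      using less2[of i] less2[of j] by (auto simp: s)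
  next
    fix i j :: nat and a b :: "'f^2^2"
    assume "i < 2" "j < 2" "a \<in> grade M11 i" "b \<in> grade M11 j"
    then show "star M11 (mult M11 a b) = smult M11 ((-1) ^ (i * j)) (mult M11 (star M11 b) (star M11 a))"
      using less2[of i] less2[of j] by (auto simp: s algebra_simps)
  qed (simp_all add: s algebra_simps)
qed

end

theory Submission
  imports Defs
begin

text \<open>
  Each of the four components of \<open>M11\<close> is one-dimensional, so the value of a word under an admissible
  substitution is a product of scalars, which is the same for all multilinear words, times the
  value of the word at the generators. The latter depends only on the kinds of the letters.
  Hence the multilinear identities are the kernel of the evaluation at the generators, the group
  acts trivially on the quotient, and the cocharacter is the dimension of the image: a word
  vanishes unless its odd letters alternate between \<open>e_21\<close> and \<open>e_12\<close>.

  For the multiplicities, complete orthogonality of the irreducible characters is not needed.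
  The sum of all group elements annihilates every Specht module with at least two rows, because the
  column group contains a transposition; so summing a decomposition over the group determines the
  coefficient of the one-row multipartition. Evaluating at the identity, where all irreducible
  characters are positive, shows that nothing else occurs.
\<close>

no_notation vector_scalar_mult (infixl "*s" 70)

section \<open>Traces on quotient spaces\<close>

text \<open>The term whose diagonal values \<open>quot_trace\<close> adds up. It is meaningful only
  when the coordinates exist uniquely, so it is always used together with
  \<open>is_quot_basis\<close>.\<close>

definition quot_coord ::
  "('f::field \<Rightarrow> 'v::ab_group_add \<Rightarrow> 'v) \<Rightarrow> 'v set \<Rightarrow> 'v set \<Rightarrow> 'v \<Rightarrow> 'v \<Rightarrow> 'f"
  where
  "quot_coord sc W B v = (THE c. is_quot_coord sc W B v c)"

context vector_space
begin

section \<open>Coordinates and bases modulo a subspace\<close>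

lemma quot_coord:
  assumes "is_quot_basis scale V W B" "v \<in> V"
  shows "is_quot_coord scale W B v (quot_coord scale W B v)"
  using assms unfolding quot_coord_def is_quot_basis_def by (metis theI')

lemma quot_coord_mem:
  assumes "is_quot_basis scale V W B" "v \<in> V"
  shows "v - (\<Sum>b\<in>B. quot_coord scale W B v b *s b) \<in> W"
  using quot_coord[OF assms] by (simp add: is_quot_coord_def)

lemma quot_coord_eq:
  assumes "is_quot_basis scale V W B" "v \<in> V" "v - (\<Sum>b\<in>B. c b *s b) \<in> W" "b \<in> B"
  shows "quot_coord scale W B v b = c b"
proof -
  \<comment> \<open>\<open>is_quot_coord\<close> demands zero outside \<open>B\<close>, while
    \<open>c\<close> is arbitrary there; cutting it off makes the uniqueness applicable.\<close>
  let ?c = "\<lambda>b. if b \<in> B then c b else 0"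
  have "(\<Sum>b\<in>B. ?c b *s b) = (\<Sum>b\<in>B. c b *s b)"
    by (intro sum.cong) auto
  then have "is_quot_coord scale W B v ?c"
    using assms(3) by (simp add: is_quot_coord_def)
  then have "quot_coord scale W B v = ?c"
    using assms(1,2) quot_coord[OF assms(1,2)] unfolding is_quot_basis_def by blast
  then show ?thesis using assms(4) by simp
qed

text \<open>Two coordinate families of one vector differ by a combination lying in \<open>W\<close>,
  so independence modulo \<open>W\<close> makes them equal on \<open>B\<close>; outside
  \<open>B\<close> both vanish by convention.\<close>

lemma is_quot_basisI:
  assumes "finite B" "B \<subseteq> V"
    and ex: "\<And>v. v \<in> V \<Longrightarrow> \<exists>c. v - (\<Sum>b\<in>B. c b *s b) \<in> W"
    and indep: "\<And>c b. (\<Sum>b\<in>B. c b *s b) \<in> W \<Longrightarrow> b \<in> B \<Longrightarrow> c b = 0"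
    and W: "subspace W"
  shows "is_quot_basis scale V W B"
  unfolding is_quot_basis_def
proof (intro conjI ballI ex_ex1I)
  fix v assume "v \<in> V"
  then obtain c where c: "v - (\<Sum>b\<in>B. c b *s b) \<in> W" using ex by blast
  have "(\<Sum>b\<in>B. (if b \<in> B then c b else 0) *s b) = (\<Sum>b\<in>B. c b *s b)"
    by (intro sum.cong) auto
  with c have "is_quot_coord scale W B v (\<lambda>b. if b \<in> B then c b else 0)"
    by (simp add: is_quot_coord_def)
  then show "\<exists>c. is_quot_coord scale W B v c" by blast
next
  fix v c d
  assume c: "is_quot_coord scale W B v c" and d: "is_quot_coord scale W B v d"
  have "(v - (\<Sum>b\<in>B. d b *s b)) - (v - (\<Sum>b\<in>B. c b *s b)) \<in> W"
    by (rule subspace_diff[OF W]) (use c d in \<open>simp_all only: is_quot_coord_def\<close>)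
  then have "(\<Sum>b\<in>B. (c b - d b) *s b) \<in> W"
    by (simp add: scale_left_diff_distrib sum_subtractf)
  then have "c b - d b = 0" if "b \<in> B" for b
    using indep[of "\<lambda>b. c b - d b" b] that by blast
  moreover have "c b = d b" if "b \<notin> B" for b
    using that c d by (simp add: is_quot_coord_def)
  ultimately show "c = d" by (metis ext right_minus_eq)
qed (use assms in auto)

lemma is_quot_basis_independent:
  assumes "finite B" "independent B" "B \<subseteq> V" "V \<subseteq> span B"
  shows "is_quot_basis scale V {0} B"
proof (rule is_quot_basisI)
  fix v assume "v \<in> V"
  then obtain c where "v = (\<Sum>b\<in>B. c b *s b)"
    using assms span_finite[OF assms(1)] by auto
  then show "\<exists>c. v - (\<Sum>b\<in>B. c b *s b) \<in> {0}"
    by auto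
next
  fix c b assume "(\<Sum>b\<in>B. c b *s b) \<in> {0}" "b \<in> B"
  then show "c b = 0" using assms independentD by blast
qed (use assms in auto)

text \<open>
  If \<open>P\<close> and \<open>Q\<close> are the two base change matrices, then \<open>card B\<close> and \<open>card B'\<close> are
  the traces of \<open>P Q\<close> and \<open>Q P\<close>.
\<close>

lemma card_quot_basis_eq:
  assumes B: "is_quot_basis scale V W B" and B': "is_quot_basis scale V W B'"
    and W: "subspace W"
  shows "(of_nat (card B) :: 'a) = of_nat (card B')"
proof -
  have diag: "(\<Sum>b'\<in>C'. quot_coord scale W C' b b' * quot_coord scale W C b' b) = 1"
    if C: "is_quot_basis scale V W C" and C': "is_quot_basis scale V W C'" and b: "b \<in> C"
    for C C' b
  proof -
    have fin: "finite C" and CV: "C \<subseteq> V" and C'V: "C' \<subseteq> V"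
      using C C' by (auto simp: is_quot_basis_def)
    let ?p = "quot_coord scale W C' b" and ?q = "quot_coord scale W C"
    have "b - (\<Sum>b'\<in>C'. ?p b' *s b') \<in> W"
      using quot_coord_mem[OF C'] b CV by blast
    moreover have "(\<Sum>b'\<in>C'. ?p b' *s (b' - (\<Sum>a\<in>C. ?q b' a *s a))) \<in> W"
      using quot_coord_mem[OF C] C'V by (intro subspace_sum subspace_scale W) blast
    \<comment> \<open>Replacing each \<open>b'\<close> in the expansion of \<open>b\<close> by its
      own expansion in \<open>C\<close> expands \<open>b\<close> in \<open>C\<close> again modulo
      \<open>W\<close>, with a row of the product of the base change matrices as
      coefficients.\<close>
    ultimately have "(b - (\<Sum>b'\<in>C'. ?p b' *s b')) +
        (\<Sum>b'\<in>C'. ?p b' *s (b' - (\<Sum>a\<in>C. ?q b' a *s a))) \<in> W"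
      by (rule subspace_add[OF W])
    also have "(b - (\<Sum>b'\<in>C'. ?p b' *s b')) +
        (\<Sum>b'\<in>C'. ?p b' *s (b' - (\<Sum>a\<in>C. ?q b' a *s a))) =
        b - (\<Sum>b'\<in>C'. \<Sum>a\<in>C. (?p b' * ?q b' a) *s a)"
      by (simp add: scale_right_diff_distrib sum_subtractf scale_sum_right)
    also have "(\<Sum>b'\<in>C'. \<Sum>a\<in>C. (?p b' * ?q b' a) *s a) =
        (\<Sum>a\<in>C. (\<Sum>b'\<in>C'. ?p b' * ?q b' a) *s a)"
      by (subst sum.swap) (simp add: scale_sum_left)
    finally have "?q b b = (\<Sum>b'\<in>C'. ?p b' * ?q b' b)"
      using quot_coord_eq[OF C _ _ b, of b "\<lambda>a. \<Sum>b'\<in>C'. ?p b' * ?q b' a"] b CV by blast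
    \<comment> \<open>The trivial expansion of \<open>b\<close> shows that its own coordinate is 1,
      hence so is the diagonal entry of the product.\<close>
    moreover have "?q b b = (if b = b then 1 else 0)"
    proof (rule quot_coord_eq[OF C _ _ b, where c = "\<lambda>a. if b = a then 1 else 0"])
      have "(\<Sum>a\<in>C. (if b = a then 1 else 0) *s a) = (\<Sum>a\<in>C. if b = a then a else 0)"
        by (intro sum.cong) auto
      also have "\<dots> = b" using fin b by simp
      finally show "b - (\<Sum>a\<in>C. (if b = a then 1 else 0) *s a) \<in> W"
        using subspace_0[OF W] by simp
    qed (use b CV in auto)
    ultimately show ?thesis by simp
  qed
  have "(of_nat (card B) :: 'a) = (\<Sum>b\<in>B. \<Sum>b'\<in>B'. quot_coord scale W B' b b' * quot_coord scale W B b' b)"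
    using diag[OF B B'] by simp
  also have "\<dots> = (\<Sum>b'\<in>B'. \<Sum>b\<in>B. quot_coord scale W B b' b * quot_coord scale W B' b b')"
    by (subst sum.swap) (simp add: mult.commute)
  also have "\<dots> = of_nat (card B')"
    using diag[OF B' B] by simp
  finally show ?thesis .
qed

text \<open>\<open>quot_trace\<close> works in a basis \<open>C\<close> picked by Hilbert choice.
  The induced matrix is the identity in every basis, so the trace is \<open>card C\<close> as a
  field element, and comparing bases replaces \<open>C\<close> by \<open>B\<close>.\<close>

lemma quot_trace_trivial_action:
  assumes B: "is_quot_basis scale V W B" and V: "subspace V" and W: "subspace W" "W \<subseteq> V"
    and f: "\<And>v. v \<in> V \<Longrightarrow> f v - v \<in> W"
  shows "quot_trace scale V W f = of_nat (card B)"
proof -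
  define C where "C = (SOME C. is_quot_basis scale V W C)"
  have C: "is_quot_basis scale V W C"
    unfolding C_def using B by (rule someI)
  then have fin: "finite C" and CV: "C \<subseteq> V" by (auto simp: is_quot_basis_def)
  have "quot_coord scale W C (f b) b = (if b = b then 1 else 0)" if b: "b \<in> C" for b
  proof (rule quot_coord_eq[OF C _ _ b, where c = "\<lambda>a. if b = a then 1 else 0"])
    have "b \<in> V" using b CV by blast
    then show "f b \<in> V"
      using f[of b] W subspace_add[OF V, of "f b - b" b] by auto
    have "(\<Sum>a\<in>C. (if b = a then 1 else 0) *s a) = (\<Sum>a\<in>C. if b = a then a else 0)"
      by (intro sum.cong) auto
    also have "\<dots> = b" using fin b by simp
    finally show "f b - (\<Sum>a\<in>C. (if b = a then 1 else 0) *s a) \<in> W"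
      using f \<open>b \<in> V\<close> by simp
  qed
  then have "quot_trace scale V W f = of_nat (card C)"
    unfolding quot_trace_def Let_def C_def[symmetric] quot_coord_def[symmetric] by simp
  also have "\<dots> = of_nat (card B)"
    by (rule card_quot_basis_eq[OF C B W(1)])
  finally show ?thesis .
qed

text \<open>Coordinates modulo \<open>W\<close> are additive. The sum over \<open>G\<close> induces
  the zero map, so for each basis element the diagonal entries add up to 0.\<close>

lemma sum_quot_trace_eq_0:
  assumes B: "is_quot_basis scale V W B" and W: "subspace W"
    and f: "\<And>g v. g \<in> G \<Longrightarrow> v \<in> V \<Longrightarrow> f g v \<in> V"
    and sum_f: "\<And>v. v \<in> V \<Longrightarrow> (\<Sum>g\<in>G. f g v) \<in> W"
    and V: "subspace V"
  shows "(\<Sum>g\<in>G. quot_trace scale V W (f g)) = 0"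
proof -
  define C where "C = (SOME C. is_quot_basis scale V W C)"
  have C: "is_quot_basis scale V W C"
    unfolding C_def using B by (rule someI)
  then have CV: "C \<subseteq> V" by (auto simp: is_quot_basis_def)
  have "(\<Sum>g\<in>G. quot_coord scale W C (f g b) b) = 0" if b: "b \<in> C" for b
  proof -
    have bV: "b \<in> V" using b CV by blast
    have "(\<Sum>g\<in>G. f g b - (\<Sum>a\<in>C. quot_coord scale W C (f g b) a *s a)) \<in> W"
      using quot_coord_mem[OF C] f bV by (intro subspace_sum W) blast
    also have "(\<Sum>g\<in>G. f g b - (\<Sum>a\<in>C. quot_coord scale W C (f g b) a *s a)) =
        (\<Sum>g\<in>G. f g b) - (\<Sum>a\<in>C. (\<Sum>g\<in>G. quot_coord scale W C (f g b) a) *s a)"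
      unfolding sum_subtractf scale_sum_left by (subst sum.swap) simp
    finally have "quot_coord scale W C (\<Sum>g\<in>G. f g b) b = (\<Sum>g\<in>G. quot_coord scale W C (f g b) b)"
      using quot_coord_eq[OF C _ _ b, of "\<Sum>g\<in>G. f g b" "\<lambda>a. \<Sum>g\<in>G. quot_coord scale W C (f g b) a"]
        subspace_sum[OF V, of G "\<lambda>g. f g b"] f bV by blast
    moreover have "quot_coord scale W C (\<Sum>g\<in>G. f g b) b = 0"
      using quot_coord_eq[OF C _ _ b, of "\<Sum>g\<in>G. f g b" "\<lambda>_. 0"] sum_f[OF bV]
        subspace_sum[OF V, of G "\<lambda>g. f g b"] f bV by simp
    ultimately show ?thesis by simp
  qed
  moreover have "(\<Sum>g\<in>G. quot_trace scale V W (f g)) = (\<Sum>g\<in>G. \<Sum>b\<in>C. quot_coord scale W C (f g b) b)"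
    unfolding quot_trace_def Let_def C_def[symmetric] quot_coord_def[symmetric] ..
  moreover have "\<dots> = (\<Sum>b\<in>C. \<Sum>g\<in>G. quot_coord scale W C (f g b) b)" by (rule sum.swap)
  ultimately show ?thesis by simp
qed

end

section \<open>Linear extensions\<close>

interpretation pm: vector_space "pm_scale :: 'f::field \<Rightarrow> ('k \<Rightarrow>\<^sub>0 'f) \<Rightarrow> _"
  by (rule vector_space_pm_scale)

lemma lookup_pm_scale: "Poly_Mapping.lookup (pm_scale c f) k = c * Poly_Mapping.lookup f k"
  by (simp add: pm_scale_def Poly_Mapping.map.rep_eq when_def)

lemma pm_scale_single: "pm_scale c (Poly_Mapping.single k a) = Poly_Mapping.single k (c * a)"
  by (intro poly_mapping_eqI) (simp add: lookup_pm_scale lookup_single when_def)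

text \<open>Linearity of \<open>pm_extend\<close> and linearity of \<open>eval_poly\<close> are both
  instances.\<close>

lemma linear_extension:
  fixes sc :: "'f::field \<Rightarrow> 'v::ab_group_add \<Rightarrow> 'v"
  assumes "vector_space sc"
  shows "Vector_Spaces.linear pm_scale sc
    (\<lambda>f. \<Sum>k\<in>Poly_Mapping.keys f. sc (Poly_Mapping.lookup f k) (h (k :: 'k)))"
    (is "Vector_Spaces.linear _ _ ?L")
proof -
  interpret vector_space sc by fact
  \<comment> \<open>The support of a sum can be smaller than the union of the supports; padding with
    zero terms lets all sums run over one finite set.\<close>
  have sup: "?L f = (\<Sum>k\<in>K. sc (Poly_Mapping.lookup f k) (h k))"
    if "finite K" "Poly_Mapping.keys f \<subseteq> K" for f K
    using that by (intro sum.mono_neutral_left) (auto simp: in_keys_iff)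
  show ?thesis
  proof (unfold Vector_Spaces.linear_iff, intro conjI allI)
    fix f g :: "'k \<Rightarrow>\<^sub>0 'f"
    let ?K = "Poly_Mapping.keys f \<union> Poly_Mapping.keys g"
    have "?L (f + g) = (\<Sum>k\<in>?K. sc (Poly_Mapping.lookup (f + g) k) (h k))"
      using Poly_Mapping.keys_add[of f g] by (intro sup) auto
    also have "\<dots> = (\<Sum>k\<in>?K. sc (Poly_Mapping.lookup f k) (h k)) +
        (\<Sum>k\<in>?K. sc (Poly_Mapping.lookup g k) (h k))"
      by (simp add: lookup_add scale_left_distrib sum.distrib)
    also have "\<dots> = ?L f + ?L g" by (simp add: sup[of ?K])
    finally show "?L (f + g) = ?L f + ?L g" .
  next
    fix c and f :: "'k \<Rightarrow>\<^sub>0 'f"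
    have "?L (pm_scale c f) = (\<Sum>k\<in>Poly_Mapping.keys f. sc (Poly_Mapping.lookup (pm_scale c f) k) (h k))"
      by (intro sup) (auto simp: in_keys_iff lookup_pm_scale)
    then show "?L (pm_scale c f) = sc c (?L f)"
      by (simp add: lookup_pm_scale scale_sum_right)
  qed (rule vector_space_pm_scale, fact)
qed

lemma linear_pm_extend: "Vector_Spaces.linear pm_scale pm_scale (pm_extend h)"
  using linear_extension[OF vector_space_pm_scale, of "\<lambda>k. Poly_Mapping.single (h k) 1"]
  by (simp add: pm_extend_def[abs_def] pm_scale_single)

lemma pm_extend_single: "pm_extend h (Poly_Mapping.single k a) = Poly_Mapping.single (h k) a"
  by (simp add: pm_extend_def)

lemma pm_eq_sum_single:
  "f = (\<Sum>k\<in>Poly_Mapping.keys f. Poly_Mapping.single k (Poly_Mapping.lookup f k))"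
proof (rule poly_mapping_eqI)
  fix j
  show "Poly_Mapping.lookup f j = Poly_Mapping.lookup
      (\<Sum>k\<in>Poly_Mapping.keys f. Poly_Mapping.single k (Poly_Mapping.lookup f k)) j"
    by (simp add: lookup_sum lookup_single when_def in_keys_iff)
qed

lemma linear_pm_eqI:
  assumes f: "Vector_Spaces.linear pm_scale sc f" and g: "Vector_Spaces.linear pm_scale sc g"
    and eq: "\<And>k a. f (Poly_Mapping.single k a) = g (Poly_Mapping.single k a)"
  shows "f x = g x"
proof -
  interpret f: Vector_Spaces.linear pm_scale sc f by (rule f)
  interpret g: Vector_Spaces.linear pm_scale sc g by (rule g)
  let ?x = "\<Sum>k\<in>Poly_Mapping.keys x. Poly_Mapping.single k (Poly_Mapping.lookup x k)"
  have "f x = f ?x" by (rule arg_cong[OF pm_eq_sum_single])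
  also have "\<dots> = g ?x" by (simp add: f.sum g.sum eq)
  also have "\<dots> = g x" by (rule arg_cong[OF pm_eq_sum_single, symmetric])
  finally show ?thesis .
qed

section \<open>Specht modules\<close>

lemma tableau_inject:
  assumes "tableau \<mu> r c = tableau \<mu> r' c'"
    and "r < length \<mu>" "c < \<mu> ! r" "r' < length \<mu>" "c' < \<mu> ! r'"
  shows "r = r' \<and> c = c'"
proof -
  \<comment> \<open>Every entry of row \<open>r\<close> is at most the total length of the rows up
    to \<open>r\<close>, and every entry of a later row exceeds it.\<close>
  have less: "tableau \<mu> r c < tableau \<mu> r' c'"
    if "r < r'" "r' < length \<mu>" "c < \<mu> ! r" for r r' c c'
  proof -
    have "sum_list (take r' \<mu>) = sum_list (take (Suc r) \<mu>) + sum_list (take (r' - Suc r) (drop (Suc r) \<mu>))"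
      using that by (metis Suc_leI le_add_diff_inverse sum_list_append take_add)
    then show ?thesis
      using that by (simp add: tableau_def take_Suc_conv_app_nth)
  qed
  show ?thesis
    using less[of r r' c c'] less[of r' r c' c] assms
    by (cases r r' rule: linorder_cases) (auto simp: tableau_def)
qed

lemma tableau_surj:
  assumes "1 \<le> x" "x \<le> sum_list \<mu>"
  shows "\<exists>r c. r < length \<mu> \<and> c < \<mu> ! r \<and> x = tableau \<mu> r c"
  using assms
proof (induction \<mu> arbitrary: x)
  case (Cons k \<mu>)
  show ?case
  proof (cases "x \<le> k")
    case True
    then show ?thesis using Cons.prems by (intro exI[of _ 0] exI[of _ "x - 1"]) (auto simp: tableau_def)
  next
    case False
    \<comment> \<open>Beyond the first row, of length \<open>k\<close>, the entries are those of the
      remaining tableau shifted by \<open>k\<close>.\<close>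
    have "1 \<le> x - k" "x - k \<le> sum_list \<mu>" using Cons.prems False by auto
    then obtain r c where "r < length \<mu>" "c < \<mu> ! r" "x - k = tableau \<mu> r c"
      using Cons.IH[of "x - k"] by blast
    then show ?thesis
      using False by (intro exI[of _ "Suc r"] exI[of _ c]) (auto simp: tableau_def)
  qed
qed simp

lemma tableau_mem:
  assumes "r < length \<mu>" "c < \<mu> ! r"
  shows "tableau \<mu> r c \<in> {1..sum_list \<mu>}"
proof -
  have "sum_list \<mu> = sum_list (take (Suc r) \<mu>) + sum_list (drop (Suc r) \<mu>)"
    by (metis append_take_drop_id sum_list_append)
  then show ?thesis
    using assms by (simp add: tableau_def take_Suc_conv_app_nth)
qed

section \<open>Row group, column group and Young symmetrizer\<close>

lemma finite_row_group: "finite (row_group \<mu>)"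
  by (rule finite_subset[of _ "{p. p permutes {1..sum_list \<mu>}}"])
    (auto simp: row_group_def finite_permutations)

lemma finite_col_group: "finite (col_group \<mu>)"
  by (rule finite_subset[of _ "{p. p permutes {1..sum_list \<mu>}}"])
    (auto simp: col_group_def finite_permutations)

lemma id_in_row_group: "id \<in> row_group \<mu>"
  by (simp add: row_group_def permutes_id)

lemma id_in_col_group: "id \<in> col_group \<mu>"
  by (simp add: col_group_def permutes_id)

text \<open>Row and column group meet trivially: \<open>q\<close> keeps \<open>x\<close> in its
  column, and \<open>p\<close> carries \<open>q x\<close> back to \<open>x\<close> inside a row, so
  the boxes of \<open>x\<close> and \<open>q x\<close> share row and column and coincide.\<close>

lemma row_col_comp_eq_id:
  assumes p: "p \<in> row_group \<mu>" and q: "q \<in> col_group \<mu>" and pq: "p \<circ> q = id"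
  shows "p = id \<and> q = id"
proof -
  have "q x = x" for x
  proof (cases "x \<in> {1..sum_list \<mu>}")
    case False
    then show ?thesis
      using q by (metis (mono_tags, lifting) col_group_def mem_Collect_eq permutes_not_in)
  next
    case True
    then obtain r c where rc: "r < length \<mu>" "c < \<mu> ! r" "x = tableau \<mu> r c"
      using tableau_surj[of x \<mu>] by auto
    have "x \<in> col_entries \<mu> c" using rc by (auto simp: col_entries_def)
    then have "q x \<in> col_entries \<mu> c" using q by (auto simp: col_group_def)
    then obtain r' where r': "r' < length \<mu>" "c < \<mu> ! r'" "q x = tableau \<mu> r' c"
      by (auto simp: col_entries_def)
    have "p (q x) = x" using pq by (metis comp_apply id_apply)
    moreover have "q x \<in> row_entries \<mu> r'" using r' by (auto simp: row_entries_def)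
    moreover have "p ` row_entries \<mu> r' = row_entries \<mu> r'"
      using p by (simp add: row_group_def)
    ultimately have "x \<in> row_entries \<mu> r'"
      by (metis imageI)
    then obtain c' where "r' < length \<mu>" "c' < \<mu> ! r'" "x = tableau \<mu> r' c'"
      by (auto simp: row_entries_def)
    then show ?thesis using tableau_inject[of \<mu> r c r' c'] rc r' by simp
  qed
  then have "q = id" by auto
  with pq show ?thesis by simp
qed

text \<open>Only \<open>p = q = id\<close> contributes to the coefficient at \<open>id\<close>,
  which is therefore 1 in every characteristic.\<close>

lemma young_symmetrizer_nonzero: "(young_symmetrizer \<mu> :: (nat \<Rightarrow> nat) \<Rightarrow>\<^sub>0 'f::field) \<noteq> 0"
proof -
  have "Poly_Mapping.lookup (young_symmetrizer \<mu> :: _ \<Rightarrow>\<^sub>0 'f) id =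
      (\<Sum>p\<in>row_group \<mu>. \<Sum>q\<in>col_group \<mu>. of_int (sign q) when p \<circ> q = id)"
    by (simp add: young_symmetrizer_def lookup_sum lookup_single)
  also have "\<dots> = (\<Sum>p\<in>row_group \<mu>. \<Sum>q\<in>col_group \<mu>. if q = id then (if p = id then 1 else 0) else 0)"
    using row_col_comp_eq_id[of _ \<mu>] by (intro sum.cong refl) (force simp: when_def)
  also have "\<dots> = 1"
    by (simp add: finite_row_group finite_col_group id_in_row_group id_in_col_group)
  finally show ?thesis by (metis lookup_zero zero_neq_one)
qed

section \<open>Left multiplication on the group algebra and on Specht modules\<close>

lemma linear_left_mult: "Vector_Spaces.linear pm_scale pm_scale (left_mult p)"
  unfolding left_mult_def by (rule linear_pm_extend)

interpretation lm: Vector_Spaces.linear pm_scale pm_scale "left_mult p"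
  for p :: "nat \<Rightarrow> nat"
  by (rule linear_left_mult)

lemma left_mult_single: "left_mult p (Poly_Mapping.single q a) = Poly_Mapping.single (p \<circ> q) a"
  by (simp add: left_mult_def pm_extend_single)

lemma left_mult_left_mult: "left_mult p (left_mult q f) = left_mult (p \<circ> q) f"
proof -
  have "(left_mult p \<circ> left_mult q) f = left_mult (p \<circ> q) f"
    by (rule linear_pm_eqI[OF Vector_Spaces.linear_compose[OF linear_left_mult linear_left_mult]
          linear_left_mult]) (simp add: left_mult_single o_assoc)
  then show ?thesis by simp
qed

lemma left_mult_id: "left_mult id f = f"
  by (rule linear_pm_eqI[OF linear_left_mult pm.linear_ident]) (simp add: left_mult_single)

lemma left_mult_specht_module:
  assumes "p permutes {1..sum_list \<mu>}" "v \<in> specht_module \<mu>"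
  shows "left_mult p v \<in> specht_module \<mu>"
  using assms(2) unfolding specht_module_def
proof (induction v rule: pm.span_induct_alt)
  case (step c x y)
  then obtain q where q: "x = left_mult q (young_symmetrizer \<mu>)" "q permutes {1..sum_list \<mu>}"
    by blast
  have "left_mult p x \<in> {left_mult p (young_symmetrizer \<mu>) |p. p permutes {1..sum_list \<mu>}}"
    using q permutes_compose[OF q(2) assms(1)] by (auto simp: left_mult_left_mult)
  then show ?case
    using step.IH by (simp add: lm.add lm.scale pm.span_add pm.span_scale pm.span_base)
qed (simp add: pm.span_zero)

text \<open>Finitely many generators bound the dimension, and \<open>B\<close> is nonempty because
  the module contains the nonzero Young symmetrizer.\<close>

lemma specht_module_basis:
  obtains B :: "((nat \<Rightarrow> nat) \<Rightarrow>\<^sub>0 'f::field) set"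
  where "is_quot_basis pm_scale (specht_module \<mu>) {0} B" "B \<noteq> {}"
proof -
  let ?G = "{left_mult p (young_symmetrizer \<mu> :: _ \<Rightarrow>\<^sub>0 'f) |p. p permutes {1..sum_list \<mu>}}"
  have fin: "finite ?G"
    by (simp add: finite_permutations)
  obtain B :: "((nat \<Rightarrow> nat) \<Rightarrow>\<^sub>0 'f) set" where B: "B \<subseteq> specht_module \<mu>" "pm.independent B" "specht_module \<mu> \<subseteq> pm.span B"
    using pm.maximal_independent_subset by blast
  have "finite B"
    using pm.independent_span_bound[OF fin B(2)] B(1) by (simp add: specht_module_def)
  then have "is_quot_basis pm_scale (specht_module \<mu>) {0} B"
    using B by (intro pm.is_quot_basis_independent)
  moreover have "left_mult id (young_symmetrizer \<mu> :: _ \<Rightarrow>\<^sub>0 'f) \<in> ?G"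
    using permutes_id by blast
  then have "(young_symmetrizer \<mu> :: _ \<Rightarrow>\<^sub>0 'f) \<in> specht_module \<mu>"
    unfolding specht_module_def left_mult_id by (rule pm.span_base)
  then have "B \<noteq> {}"
    using B(3) young_symmetrizer_nonzero[of \<mu>, where 'f='f] by auto
  ultimately show ?thesis by (rule that)
qed

section \<open>Degrees of the irreducible characters\<close>

lemma subspace_specht_module: "pm.subspace (specht_module \<mu>)"
  unfolding specht_module_def by (rule pm.subspace_span)

text \<open>The witness \<open>d\<close> is the dimension of the Specht module, on which
  \<open>id\<close> acts trivially. Positivity is recorded for the natural number because the final
  counting takes place in the naturals.\<close>

lemma irr_char_id:
  obtains d where "0 < d" "irr_char \<mu> id = (of_nat d :: 'f::field)"
proof -
  obtain B :: "((nat \<Rightarrow> nat) \<Rightarrow>\<^sub>0 'f::field) set"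
    where B: "is_quot_basis pm_scale (specht_module \<mu>) {0} B" "B \<noteq> {}"
    by (rule specht_module_basis)
  have "irr_char \<mu> id = (of_nat (card B) :: 'f)"
    unfolding irr_char_def
    using subspace_specht_module
    by (intro pm.quot_trace_trivial_action[OF B(1)]) (auto simp: left_mult_id pm.subspace_0)
  moreover have "0 < card B"
    using B by (auto simp: is_quot_basis_def card_gt_0_iff)
  ultimately show ?thesis using that by blast
qed

section \<open>Shapes with at most one row\<close>

lemma row_group_row:
  assumes "length \<mu> \<le> 1"
  shows "row_group \<mu> = {p. p permutes {1..sum_list \<mu>}}"
proof (cases \<mu>)
  case Nil
  then show ?thesis by (auto simp: row_group_def row_entries_def)
next
  case (Cons k \<nu>)
  then have \<mu>: "\<mu> = [k]" using assms by simp
  have row: "row_entries \<mu> r = (if r = 0 then {1..k} else {})" for r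
  proof -
    have "{Suc c |c. c < k} = {Suc 0..k}"
      by (auto intro: exI[of _ "x - 1" for x] simp: image_iff) (metis Suc_le_D Suc_le_eq)
    then show ?thesis by (auto simp: \<mu> row_entries_def tableau_def)
  qed
  have "p ` row_entries \<mu> r = row_entries \<mu> r" if "p permutes {1..k}" for p r
    using permutes_image[OF that] by (simp add: row)
  then show ?thesis by (auto simp: \<mu> row_group_def)
qed

text \<open>The row group is the whole symmetric group, so left multiplication by \<open>p\<close>
  merely reindexes the sum over it.\<close>

lemma left_mult_young_symmetrizer_row:
  assumes "length \<mu> \<le> 1" and p: "p permutes {1..sum_list \<mu>}"
  shows "left_mult p (young_symmetrizer \<mu>) = young_symmetrizer \<mu>"
proof -
  let ?f = "\<lambda>r. \<Sum>q\<in>col_group \<mu>. Poly_Mapping.single (r \<circ> q) (of_int (sign q))"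
  have "left_mult p (young_symmetrizer \<mu>) = (\<Sum>r\<in>row_group \<mu>. ?f (p \<circ> r))"
    by (simp add: young_symmetrizer_def lm.sum left_mult_single o_assoc)
  also have "\<dots> = (\<Sum>r\<in>row_group \<mu>. ?f r)"
    unfolding row_group_row[OF assms(1)] by (rule setum_permutations_compose_left[OF p, symmetric])
  finally show ?thesis by (simp add: young_symmetrizer_def)
qed

text \<open>All generators of the module coincide with the Young symmetrizer, so the module is a
  line with trivial action. The empty shape is included.\<close>

lemma irr_char_row:
  assumes "length \<mu> \<le> 1" "p permutes {1..sum_list \<mu>}"
  shows "irr_char \<mu> p = (1 :: 'f::field)"
proof -
  let ?y = "young_symmetrizer \<mu> :: (nat \<Rightarrow> nat) \<Rightarrow>\<^sub>0 'f"
  have gen: "{left_mult p ?y |p. p permutes {1..sum_list \<mu>}} = {?y}"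
    by (auto simp: left_mult_young_symmetrizer_row[OF assms(1)] left_mult_id
        intro!: exI[of _ id] permutes_id)
  have "is_quot_basis pm_scale (specht_module \<mu>) {0} {?y}"
    unfolding specht_module_def gen
    by (intro pm.is_quot_basis_independent)
      (simp_all add: young_symmetrizer_nonzero pm.span_base)
  moreover have "left_mult p v - v \<in> {0}" if "v \<in> specht_module \<mu>" for v :: "_ \<Rightarrow>\<^sub>0 'f"
    using that left_mult_young_symmetrizer_row[OF assms]
    unfolding specht_module_def gen by (auto simp: pm.span_singleton lm.scale)
  ultimately have "irr_char \<mu> p = (of_nat (card {?y}) :: 'f)"
    unfolding irr_char_def
    using subspace_specht_module
    by (intro pm.quot_trace_trivial_action) (auto simp: pm.subspace_0)
  then show ?thesis by simp
qed

section \<open>Shapes with at least two rows\<close>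

lemma sum_sign_col_group:
  assumes "partition_of m \<mu>" "\<not> length \<mu> \<le> 1"
  shows "(\<Sum>q\<in>col_group \<mu>. sign q) = 0"
proof -
  \<comment> \<open>These are the two topmost boxes of the first column. Their transposition
    \<open>?t\<close> preserves the columns, and composing with it pairs the even with the odd
    elements of the column group.\<close>
  define a b where "a = tableau \<mu> 0 0" and "b = tableau \<mu> 1 0"
  have len: "0 < length \<mu>" "1 < length \<mu>" using assms by auto
  then have pos: "0 < \<mu> ! 0" "0 < \<mu> ! 1" "0 < length \<mu>" "1 < length \<mu>"
    using assms nth_mem[of 0 \<mu>] nth_mem[of 1 \<mu>] by (auto simp: partition_of_def)
  have ab: "a \<in> {1..sum_list \<mu>}" "b \<in> {1..sum_list \<mu>}"
    unfolding a_def b_def using pos tableau_mem by blast+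
  have "a \<noteq> b" unfolding a_def b_def using tableau_inject[of \<mu> 0 0 1 0] pos by auto
  let ?t = "Transposition.transpose a b"
  have t: "?t permutes {1..sum_list \<mu>}" using ab by (simp add: permutes_swap_id)
  \<comment> \<open>Each number occupies a single box, so \<open>a\<close> and \<open>b\<close> lie
    in column 0 and in no other; \<open>?t\<close> therefore preserves every column.\<close>
  have entry: "a \<in> col_entries \<mu> c \<longleftrightarrow> c = 0" "b \<in> col_entries \<mu> c \<longleftrightarrow> c = 0" for c
    unfolding a_def b_def col_entries_def
    using tableau_inject[of \<mu> 0 0 _ c] tableau_inject[of \<mu> 1 0 _ c] pos by blast+
  have t_col: "?t ` col_entries \<mu> c = col_entries \<mu> c" for c
    using entry[of c] by (simp add: transpose_image_eq)
  have closed: "?t \<circ> q \<in> col_group \<mu>" if "q \<in> col_group \<mu>" for q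
  proof -
    have "q permutes {1..sum_list \<mu>}" "\<And>c. q ` col_entries \<mu> c = col_entries \<mu> c"
      using that by (auto simp: col_group_def)
    moreover from this have "(?t \<circ> q) ` col_entries \<mu> c = col_entries \<mu> c" for c
      using t_col by (metis image_comp)
    ultimately show ?thesis
      using permutes_compose[OF _ t] by (simp add: col_group_def)
  qed
  have "(\<Sum>q\<in>col_group \<mu>. sign q) = (\<Sum>q\<in>col_group \<mu>. sign (?t \<circ> q))"
    by (rule sum.reindex_bij_witness[of _ "(\<circ>) ?t" "(\<circ>) ?t"])
      (auto simp: closed o_assoc)
  also have "\<dots> = (\<Sum>q\<in>col_group \<mu>. - sign q)"
  proof (rule sum.cong)
    fix q assume "q \<in> col_group \<mu>"
    then have "permutation q" by (auto simp: col_group_def permutation_permutes)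
    then show "sign (?t \<circ> q) = - sign q"
      using \<open>a \<noteq> b\<close> by (simp add: sign_compose sign_swap_id permutation_swap_id)
  qed simp
  finally show ?thesis by (simp add: sum_negf)
qed

text \<open>Let N be the sum of all permutations. Since N absorbs every permutation on its right,
  its product with the Young symmetrizer is a multiple of the sum of the column signs, which is 0.
  So N annihilates the Specht module and has trace 0 there.\<close>

lemma sum_irr_char_nonrow:
  assumes "partition_of m \<mu>" "\<not> length \<mu> \<le> 1"
  shows "(\<Sum>p | p permutes {1..m}. irr_char \<mu> p) = (0 :: 'f::field)"
proof -
  have m: "m = sum_list \<mu>" using assms by (simp add: partition_of_def)
  let ?y = "young_symmetrizer \<mu> :: (nat \<Rightarrow> nat) \<Rightarrow>\<^sub>0 'f"
  let ?G = "{p. p permutes {1..m}}"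
  let ?N = "\<lambda>a. \<Sum>p\<in>?G. Poly_Mapping.single p a :: (nat \<Rightarrow> nat) \<Rightarrow>\<^sub>0 'f"
  have y: "(\<Sum>g\<in>?G. left_mult g ?y) = 0"
  proof -
    have "(\<Sum>g\<in>?G. left_mult g ?y) =
        (\<Sum>g\<in>?G. \<Sum>p\<in>row_group \<mu>. \<Sum>q\<in>col_group \<mu>. Poly_Mapping.single (g \<circ> (p \<circ> q)) (of_int (sign q)))"
      by (simp add: young_symmetrizer_def lm.sum left_mult_single)
    also have "\<dots> = (\<Sum>p\<in>row_group \<mu>. \<Sum>q\<in>col_group \<mu>. \<Sum>g\<in>?G.
        Poly_Mapping.single (g \<circ> (p \<circ> q)) (of_int (sign q)))"
      unfolding sum.swap[of _ _ ?G] ..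
    also have "\<dots> = (\<Sum>p\<in>row_group \<mu>. \<Sum>q\<in>col_group \<mu>. ?N (of_int (sign q)))"
    proof (rule sum.cong[OF refl], rule sum.cong[OF refl])
      fix p q assume "p \<in> row_group \<mu>" "q \<in> col_group \<mu>"
      then have "p \<circ> q permutes {1..m}"
        by (auto simp: row_group_def col_group_def m intro: permutes_compose)
      then show "(\<Sum>g\<in>?G. Poly_Mapping.single (g \<circ> (p \<circ> q)) (of_int (sign q))) = ?N (of_int (sign q))"
        using sum_permutations_compose_right[of "p \<circ> q" "{1..m}" "\<lambda>g. Poly_Mapping.single g (of_int (sign q) :: 'f)"]
        by simp
    qed
    also have "\<dots> = (\<Sum>p\<in>row_group \<mu>. pm_scale (of_int (\<Sum>q\<in>col_group \<mu>. sign q)) (?N 1))"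
      by (simp only: of_int_sum pm.scale_sum_left) (simp only: pm.scale_sum_right pm_scale_single mult_1_right)
    also have "\<dots> = 0" by (simp add: sum_sign_col_group[OF assms])
    finally show ?thesis .
  qed
  have "(\<Sum>g\<in>?G. left_mult g v) \<in> {0}" if "v \<in> specht_module \<mu>" for v :: "_ \<Rightarrow>\<^sub>0 'f"
    using that unfolding specht_module_def
  proof (induction v rule: pm.span_induct_alt)
    case (step c x v)
    then obtain q where q: "x = left_mult q ?y" "q permutes {1..m}"
      by (auto simp: m)
    \<comment> \<open>For a generator \<open>left_mult q ?y\<close> the factor \<open>q\<close> is
      absorbed by reindexing the sum over the group.\<close>
    have "(\<Sum>g\<in>?G. left_mult g x) = (\<Sum>g\<in>?G. left_mult (g \<circ> q) ?y)"
      by (simp add: q left_mult_left_mult)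
    also have "\<dots> = (\<Sum>g\<in>?G. left_mult g ?y)"
      by (rule sum_permutations_compose_right[OF q(2), symmetric])
    finally show ?case
      using y step.IH by (simp add: lm.add lm.scale sum.distrib pm.scale_sum_right[symmetric])
  qed simp
  moreover obtain B :: "((nat \<Rightarrow> nat) \<Rightarrow>\<^sub>0 'f::field) set"
    where "is_quot_basis pm_scale (specht_module \<mu>) {0} B"
    by (rule specht_module_basis)
  ultimately show ?thesis
    unfolding irr_char_def
    using left_mult_specht_module subspace_specht_module
    by (intro pm.sum_quot_trace_eq_0) (auto simp: m pm.subspace_0)
qed

section \<open>The star-identities of the matrix superalgebra\<close>

text \<open>A generator of each of the one-dimensional components of \<open>M11\<close>.\<close>

primrec kind_unit :: "vkind \<Rightarrow> 'f::field^2^2" where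
  "kind_unit Y0 = vector [vector [1, 0], vector [0, 1]]"
| "kind_unit Z0 = vector [vector [1, 0], vector [0, -1]]"
| "kind_unit Y1 = vector [vector [0, 0], vector [1, 0]]"
| "kind_unit Z1 = vector [vector [0, 1], vector [0, 0]]"

abbreviation eval_units :: "'f::field free_algebra \<Rightarrow> 'f^2^2" where
  "eval_units \<equiv> eval_poly M11 (\<lambda>v. kind_unit (fst v))"

text \<open>The generators depend on the kind alone, so the value of a word at them is a function of
  its list of kinds and is blind to the indices.\<close>

definition kinds_prod :: "vkind list \<Rightarrow> 'f::field^2^2" where
  "kinds_prod ks = foldr (\<lambda>k X. kind_unit k ** X) ks (mat 1)"

section \<open>Multilinear identities and evaluation at the generators\<close>

interpretation M11: star_algebra M11
  by (rule star_algebra_M11)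

lemma smult_M11_nth [simp]: "smult M11 c X $ i $ j = c * X $ i $ j"
  by (simp add: M11_def)

text \<open>For an odd matrix, symmetry makes the upper right entry equal to its negative, and
  skewness does the same to the lower left entry; these entries vanish in characteristic
  zero.\<close>

lemma component_M11:
  fixes X :: "'f::field_char_0^2^2"
  shows "X \<in> component M11 s \<longleftrightarrow> (\<exists>c. X = smult M11 c (kind_unit s))"
proof -
  have "X \<in> component M11 Y0 \<longleftrightarrow> (\<exists>c. X = smult M11 c (kind_unit Y0))"
    "X \<in> component M11 Z0 \<longleftrightarrow> (\<exists>c. X = smult M11 c (kind_unit Z0))"
    "X \<in> component M11 Y1 \<longleftrightarrow> (\<exists>c. X = smult M11 c (kind_unit Y1))"
    "X \<in> component M11 Z1 \<longleftrightarrow> (\<exists>c. X = smult M11 c (kind_unit Z1))"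
    by (auto simp: sym_part_def skew_part_def M11_def vec_eq_iff forall_2 vector_2)
  then show ?thesis by (cases s) simp_all
qed

lemma eval_word_M11:
  fixes \<phi> :: "var \<Rightarrow> 'f::field^2^2"
  assumes "\<And>v. v \<in> set w \<Longrightarrow> \<phi> v = smult M11 (c v) (kind_unit (fst v))"
  shows "eval_word M11 \<phi> w = smult M11 (prod_list (map c w)) (kinds_prod (map fst w))"
  using assms
proof (induction w)
  case Nil
  then show ?case by (simp add: eval_word_def kinds_prod_def) (simp add: M11_def)
next
  case (Cons v w)
  have "eval_word M11 \<phi> (v # w) = mult M11 (\<phi> v) (eval_word M11 \<phi> w)"
    by (simp add: eval_word_def)
  also have "\<dots> = mult M11 (smult M11 (c v) (kind_unit (fst v)))
      (smult M11 (prod_list (map c w)) (kinds_prod (map fst w)))"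
    using Cons by simp
  also have "\<dots> = smult M11 (prod_list (map c (v # w))) (mult M11 (kind_unit (fst v)) (kinds_prod (map fst w)))"
    by (simp add: M11.mult_smult_left M11.mult_smult_right mult.commute)
  also have "mult M11 (kind_unit (fst v)) (kinds_prod (map fst w)) = (kinds_prod (map fst (v # w)) :: 'f^2^2)"
    by (simp add: kinds_prod_def M11_def)
  finally show ?case .
qed

lemma eval_word_units: "eval_word M11 (\<lambda>v. kind_unit (fst v)) w = (kinds_prod (map fst w) :: 'f::field^2^2)"
proof -
  have "prod_list (map (\<lambda>_. 1) w) = (1 :: 'f)" by (induction w) auto
  then show ?thesis
    using eval_word_M11[of w "\<lambda>v. kind_unit (fst v)" "\<lambda>_. 1 :: 'f"] by simp
qed

lemma linear_eval_units: "Vector_Spaces.linear pm_scale (smult M11) (eval_units :: 'f::field free_algebra \<Rightarrow> _)"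
  unfolding eval_poly_def[abs_def] by (rule linear_extension[OF M11.vector_space_axioms])

interpretation eu: Vector_Spaces.linear pm_scale "smult M11" eval_units
  by (rule linear_eval_units)

lemma eval_units_single:
  "eval_units (Poly_Mapping.single w a) = smult M11 a (kinds_prod (map fst w))"
  by (simp add: eval_poly_def eval_word_units)

text \<open>The generators are themselves admissible, which gives one direction. Conversely, all
  words of a multilinear polynomial have the same letters, so an admissible substitution multiplies
  the value at the generators by one common scalar \<open>?P\<close>.\<close>

lemma Id_star_M11_iff:
  fixes f :: "'f::field_char_0 free_algebra"
  assumes f: "f \<in> multilinear ns"
  shows "f \<in> Id_star M11 \<longleftrightarrow> eval_units f = 0"
proof
  assume "f \<in> Id_star M11"
  moreover have "kind_unit s \<in> component (M11 :: ('f, _) superinv_algebra) s" for s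
    using component_M11[of "kind_unit s" s] M11.scale_one by metis
  ultimately show "eval_units f = 0" by (simp add: Id_star_def)
next
  assume eq: "eval_units f = 0"
  show "f \<in> Id_star M11"
    unfolding Id_star_def
  proof (intro CollectI allI impI)
    fix \<phi> :: "var \<Rightarrow> 'f^2^2"
    assume "\<forall>s i. \<phi> (s, i) \<in> component M11 s"
    then have "\<forall>v. \<exists>c. \<phi> v = smult M11 c (kind_unit (fst v))"
      by (auto simp: component_M11)
    then obtain c where c: "\<And>v. \<phi> v = smult M11 (c v) (kind_unit (fst v))" by metis
    let ?P = "prod c {(s, i). 1 \<le> i \<and> i \<le> ns s}"
    have "eval_word M11 \<phi> w = smult M11 ?P (kinds_prod (map fst w))" if "w \<in> Poly_Mapping.keys f" for w
    proof -
      have "distinct w" "set w = {(s, i). 1 \<le> i \<and> i \<le> ns s}"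
        using f that by (auto simp: multilinear_def)
      then have "prod_list (map c w) = ?P"
        by (metis prod.distinct_set_conv_list)
      then show ?thesis using eval_word_M11[of w \<phi> c] c by simp
    qed
    then have "eval_poly M11 \<phi> f = smult M11 ?P (eval_units f)"
      by (simp add: eval_poly_def eval_word_units M11.scale_sum_right mult.commute)
    then show "eval_poly M11 \<phi> f = 0" using eq by simp
  qed
qed

section \<open>Permuting the indices of the variables\<close>

lemma linear_var_action: "Vector_Spaces.linear pm_scale pm_scale (var_action \<sigma>)"
  unfolding var_action_def by (rule linear_pm_extend)

text \<open>Index permutations keep the kind of every letter. This makes the action on the quotient
  trivial.\<close>

lemma eval_units_var_action: "eval_units (var_action \<sigma> f) = eval_units f"
proof -
  have "(eval_units \<circ> var_action \<sigma>) f = eval_units f"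
    by (rule linear_pm_eqI[OF Vector_Spaces.linear_compose[OF linear_var_action linear_eval_units]
          linear_eval_units])
      (simp add: var_action_def pm_extend_single eval_units_single comp_def case_prod_beta)
  then show ?thesis by simp
qed

lemma subspace_multilinear: "pm.subspace (multilinear ns)"
  using Poly_Mapping.keys_add
  by (fastforce simp: pm.subspace_def multilinear_def in_keys_iff lookup_pm_scale lookup_add)

lemma subspace_multilinear_Id: "pm.subspace (multilinear ns \<inter> Id_star (M11 :: ('f::field_char_0, _) superinv_algebra))"
proof -
  have "multilinear ns \<inter> Id_star (M11 :: ('f, _) superinv_algebra) = multilinear ns \<inter> {f. eval_units f = 0}"
    using Id_star_M11_iff by blast
  then show ?thesis
    using pm.subspace_inter[OF subspace_multilinear eu.subspace_kernel] by simp
qed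

lemma single_multilinear:
  assumes "distinct w" "set w = {(s, i). 1 \<le> i \<and> i \<le> ns s}"
  shows "Poly_Mapping.single w a \<in> multilinear ns"
  using assms by (auto simp: multilinear_def in_keys_iff lookup_single when_def split: if_splits)

lemma var_action_multilinear:
  assumes "\<sigma> \<in> sym_groups ns" "f \<in> multilinear ns"
  shows "var_action \<sigma> f \<in> multilinear ns"
proof -
  have \<sigma>: "\<sigma> s permutes {1..ns s}" for s using assms(1) by (simp add: sym_groups_def)
  let ?h = "\<lambda>(s, i). (s, \<sigma> s i)" and ?S = "{(s, i). 1 \<le> i \<and> i \<le> ns s}"
  have inj: "inj ?h"
    using permutes_inj[OF \<sigma>] by (auto simp: inj_def)
  have "(s, i) \<in> ?h ` ?S" if "(s, i) \<in> ?S" for s i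
  proof -
    have "i \<in> \<sigma> s ` {1..ns s}" using that permutes_image[OF \<sigma>[of s]] by simp
    then show ?thesis by force
  qed
  moreover have "?h ` ?S \<subseteq> ?S"
    using permutes_in_image[OF \<sigma>] by fastforce
  ultimately have S: "?h ` ?S = ?S" by auto
  have "Poly_Mapping.single (map ?h w) a \<in> multilinear ns" if "w \<in> Poly_Mapping.keys f" for w and a :: 'a
  proof (rule single_multilinear)
    have w: "distinct w" "set w = ?S" using assms(2) that by (auto simp: multilinear_def)
    show "distinct (map ?h w)" using w inj by (simp add: distinct_map inj_on_subset[OF inj])
    show "set (map ?h w) = ?S" using w S by simp
  qed
  then show ?thesis
    unfolding var_action_def pm_extend_def by (intro pm.subspace_sum subspace_multilinear)
qed

section \<open>Entries of products of generators\<close>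

lemma kinds_prod_Cons: "kinds_prod (k # ks) = kind_unit k ** kinds_prod ks"
  by (simp add: kinds_prod_def)

text \<open>
  The matrix units \<open>e_12\<close> and \<open>e_21\<close> shift the position by +1 and -1 respectively.
\<close>

lemma kinds_prod_nth_nonzero:
  fixes i j :: 2
  assumes "(kinds_prod ks :: 'f::field^2^2) $ i $ j \<noteq> 0"
  shows "int (count_list ks Z1) - int (count_list ks Y1) =
    (if j = 2 then 1 else 0) - (if i = 2 then 1 else 0)"
  using assms
proof (induction ks arbitrary: i)
  case Nil
  then show ?case by (auto simp: kinds_prod_def mat_def split: if_splits)
next
  case (Cons k ks)
  have "i = 1 \<or> i = 2" using exhaust_2 by blast
  \<comment> \<open>A row of a generator has at most one nonzero entry, so a single row of the
    remaining product decides; the induction hypothesis is applied to that row.\<close>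
  then show ?case
    using Cons.prems Cons.IH[of 1] Cons.IH[of 2]
    by (cases k) (auto simp: kinds_prod_Cons matrix_matrix_mult_def sum_2 vector_2 split: if_splits)
qed

text \<open>Turns a list of kinds into a word with distinct letters. Each index is one more than the
  number of later occurrences of the same kind, so the indices of a kind descend to 1 from left to
  right.\<close>

fun label :: "vkind list \<Rightarrow> var list" where
  "label [] = []"
| "label (k # ks) = (k, Suc (count_list ks k)) # label ks"

lemma map_fst_label [simp]: "map fst (label ks) = ks"
  by (induction ks) auto

lemma set_label: "set (label ks) = {(s, i). 1 \<le> i \<and> i \<le> count_list ks s}"
  by (induction ks) (auto simp: le_Suc_eq split: if_splits)

lemma distinct_label: "distinct (label ks)"
  by (induction ks) (auto simp: set_label)

definition kinds_word :: "vkind list \<Rightarrow> 'f::field free_algebra" where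
  "kinds_word ks = Poly_Mapping.single (label ks) 1"

lemma kinds_word_multilinear: "(\<And>s. count_list ks s = ns s) \<Longrightarrow> kinds_word ks \<in> multilinear ns"
  unfolding kinds_word_def by (rule single_multilinear) (simp_all add: distinct_label set_label)

lemma eval_units_kinds_word: "eval_units (kinds_word ks) = kinds_prod ks"
  by (simp add: kinds_word_def eval_units_single)

lemma count_list_multilinear:
  assumes "f \<in> multilinear ns" "w \<in> Poly_Mapping.keys f"
  shows "count_list (map fst w) s = ns s"
proof -
  have w: "distinct w" "set w = {(s, i). 1 \<le> i \<and> i \<le> ns s}"
    using assms by (auto simp: multilinear_def)
  have "count_list (map fst w) s = length (filter (\<lambda>v. fst v = s) w)"
    by (induction w) auto
  also have "\<dots> = card {v \<in> set w. fst v = s}"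
    using w(1) by (metis distinct_card distinct_filter set_filter)
  also have "{v \<in> set w. fst v = s} = Pair s ` {1..ns s}"
    using w(2) by auto
  also have "card \<dots> = ns s" by (simp add: card_image inj_on_def)
  finally show ?thesis .
qed

text \<open>Some word must have a nonzero entry at that position, and all words have the letter
  counts \<open>ns\<close>. The contrapositive forces most entries to vanish.\<close>

lemma eval_units_nth_nonzero:
  fixes f :: "'f::field free_algebra"
  assumes f: "f \<in> multilinear ns" and nz: "eval_units f $ i $ j \<noteq> 0"
  shows "int (ns Z1) - int (ns Y1) = (if j = 2 then 1 else 0) - (if i = 2 then 1 else 0)"
proof -
  have "eval_units f $ i $ j =
      (\<Sum>w\<in>Poly_Mapping.keys f. Poly_Mapping.lookup f w * kinds_prod (map fst w) $ i $ j)"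
    by (simp add: eval_poly_def eval_word_units)
  then obtain w where w: "w \<in> Poly_Mapping.keys f" "(kinds_prod (map fst w) :: 'f^2^2) $ i $ j \<noteq> 0"
    using nz by (metis (no_types, lifting) mult_zero_right sum.neutral)
  then show ?thesis
    using kinds_prod_nth_nonzero[OF w(2)] by (simp only: count_list_multilinear[OF f w(1)])
qed

lemma count_list_replicate: "count_list (replicate n x) y = (if x = y then n else 0)"
  by (induction n) auto

lemma count_list_concat_replicate: "count_list (concat (replicate n xs)) y = n * count_list xs y"
  by (induction n) auto

text \<open>A prefix supplying the prescribed even letters. Its matrix is diagonal with entries 1
  and \<open>(-1) ^ ns Z0\<close>, so it does not change which entries vanish.\<close>

definition even_kinds :: "(vkind \<Rightarrow> nat) \<Rightarrow> vkind list" where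
  "even_kinds ns = replicate (ns Y0) Y0 @ replicate (ns Z0) Z0"

lemma kinds_prod_even_kinds:
  fixes i j :: 2
  shows "(kinds_prod (even_kinds ns @ ks) :: 'f::field^2^2) $ i $ j =
    (if i = 1 then 1 else (-1) ^ ns Z0) * kinds_prod ks $ i $ j"
proof -
  have i: "i = 1 \<or> i = 2" using exhaust_2 by blast
  have Z: "(kinds_prod (replicate b Z0 @ ks) :: 'f^2^2) $ i $ j =
      (if i = 1 then 1 else (-1) ^ b) * kinds_prod ks $ i $ j" for b
    using i by (induction b) (auto simp: kinds_prod_Cons matrix_matrix_mult_def sum_2 vector_2)
  have "(kinds_prod (replicate a Y0 @ ls) :: 'f^2^2) $ i $ j = kinds_prod ls $ i $ j" for a ls
    using i by (induction a) (auto simp: kinds_prod_Cons matrix_matrix_mult_def sum_2 vector_2)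
  then show ?thesis by (simp add: even_kinds_def Z)
qed

text \<open>\<open>Y1\<close> times \<open>Z1\<close> is the idempotent e_22, and \<open>Z1\<close>
  times \<open>Y1\<close> is e_11. The exception at \<open>k = 0\<close> is the empty product, the
  identity matrix.\<close>

lemma kinds_prod_alternating:
  "(kinds_prod (concat (replicate k [Y1, Z1])) :: 'f::field^2^2) $ 1 $ 1 = (if k = 0 then 1 else 0)"
  "(kinds_prod (concat (replicate k [Y1, Z1])) :: 'f::field^2^2) $ 2 $ 2 = 1"
  "(kinds_prod (concat (replicate k [Z1, Y1])) :: 'f::field^2^2) $ 1 $ 1 = 1"
  "(kinds_prod (concat (replicate k [Z1, Y1])) :: 'f::field^2^2) $ 2 $ 2 = (if k = 0 then 1 else 0)"
  by (induction k)
    (auto simp: kinds_prod_Cons matrix_matrix_mult_def sum_2 vector_2 kinds_prod_def[of "[]"] mat_def)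

text \<open>Without odd letters the product is a power of \<open>kind_unit Z0\<close>. This tie
  between the diagonal entries lowers the multiplicity from 2 to 1 when both odd degrees are
  0.\<close>

lemma kinds_prod_even_only:
  assumes "count_list ks Y1 = 0" "count_list ks Z1 = 0"
  shows "(kinds_prod ks :: 'f::field^2^2) $ 2 $ 2 = (-1) ^ count_list ks Z0 * kinds_prod ks $ 1 $ 1"
  using assms
proof (induction ks)
  case Nil
  then show ?case by (simp add: kinds_prod_def mat_def)
next
  case (Cons k ks)
  then show ?case
    by (cases k) (auto simp: kinds_prod_Cons matrix_matrix_mult_def sum_2 vector_2 split: if_splits)
qed

lemma eval_units_even_only:
  fixes f :: "'f::field free_algebra"
  assumes f: "f \<in> multilinear ns" and "ns Y1 = 0" "ns Z1 = 0"
  shows "eval_units f $ 2 $ 2 = (-1) ^ ns Z0 * eval_units f $ 1 $ 1"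
proof -
  have "(kinds_prod (map fst w) :: 'f^2^2) $ 2 $ 2 = (-1) ^ ns Z0 * kinds_prod (map fst w) $ 1 $ 1"
    if "w \<in> Poly_Mapping.keys f" for w
    using kinds_prod_even_only[of "map fst w"] count_list_multilinear[OF f that] assms by simp
  then show ?thesis
    by (simp add: eval_poly_def eval_word_units sum_distrib_left mult.left_commute)
qed

section \<open>Bases of the multilinear polynomials modulo identities\<close>

lemma is_quot_basis_M11I:
  fixes B :: "'f::field_char_0 free_algebra set"
  assumes "finite B" and B: "B \<subseteq> multilinear ns"
    and ex: "\<And>f. f \<in> multilinear ns \<Longrightarrow>
      \<exists>c. eval_units f = (\<Sum>b\<in>B. smult M11 (c b) (eval_units b))"
    and indep: "\<And>c b. (\<Sum>b\<in>B. smult M11 (c b) (eval_units b)) = 0 \<Longrightarrow> b \<in> B \<Longrightarrow> c b = 0"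
  shows "is_quot_basis pm_scale (multilinear ns) (multilinear ns \<inter> Id_star M11) B"
\<comment> \<open>Multilinear identities are the kernel of \<open>eval_units\<close>, so spanning
  and independence modulo identities become spanning and independence of the values.\<close>
proof (rule pm.is_quot_basisI)
  fix f :: "'f free_algebra" assume f: "f \<in> multilinear ns"
  then obtain c where c: "eval_units f = (\<Sum>b\<in>B. smult M11 (c b) (eval_units b))"
    using ex by blast
  have "(\<Sum>b\<in>B. pm_scale (c b) b) \<in> multilinear ns"
    using B by (intro pm.subspace_sum pm.subspace_scale subspace_multilinear) auto
  then have V: "f - (\<Sum>b\<in>B. pm_scale (c b) b) \<in> multilinear ns"
    using f by (intro pm.subspace_diff subspace_multilinear)
  moreover have "eval_units (f - (\<Sum>b\<in>B. pm_scale (c b) b)) = 0"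
    by (simp add: eu.diff eu.sum eu.scale c)
  ultimately show "\<exists>c. f - (\<Sum>b\<in>B. pm_scale (c b) b) \<in> multilinear ns \<inter> Id_star M11"
    using Id_star_M11_iff[OF V] by blast
next
  fix c b assume "(\<Sum>b\<in>B. pm_scale (c b) b) \<in> multilinear ns \<inter> Id_star M11" "b \<in> B"
  then have "eval_units (\<Sum>b\<in>B. pm_scale (c b) b) = 0"
    using Id_star_M11_iff by blast
  then show "c b = 0"
    using indep[of c b] \<open>b \<in> B\<close> by (simp add: eu.sum eu.scale)
qed (use assms subspace_multilinear_Id in auto)

lemma quot_basis_M11_singleton:
  fixes b :: "'f::field_char_0 free_algebra"
  assumes "b \<in> multilinear ns" and nz: "eval_units b \<noteq> 0"
    and "\<And>f. f \<in> multilinear ns \<Longrightarrow> \<exists>c. eval_units f = smult M11 c (eval_units b)"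
  shows "is_quot_basis pm_scale (multilinear ns) (multilinear ns \<inter> Id_star M11) {b}"
proof (rule is_quot_basis_M11I)
  fix f :: "'f free_algebra" assume "f \<in> multilinear ns"
  then obtain c where "eval_units f = smult M11 c (eval_units b)" using assms by blast
  then show "\<exists>c. eval_units f = (\<Sum>b\<in>{b}. smult M11 (c b) (eval_units b))"
    by (intro exI[of _ "\<lambda>_. c"]) simp
qed (use assms M11.scale_eq_0_iff in auto)

lemma M11_eqI:
  fixes X Y :: "'f^2^2"
  shows "X $ 1 $ 1 = Y $ 1 $ 1 \<Longrightarrow> X $ 1 $ 2 = Y $ 1 $ 2 \<Longrightarrow> X $ 2 $ 1 = Y $ 2 $ 1 \<Longrightarrow> X $ 2 $ 2 = Y $ 2 $ 2 \<Longrightarrow> X = Y"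
  by (simp add: vec_eq_iff forall_2)

text \<open>The dimension of the space of values at the generators: the number of matrix positions
  that can be nonzero, less one when there are no odd letters.\<close>

definition row_multiplicity :: "(vkind \<Rightarrow> nat) \<Rightarrow> nat" where
  "row_multiplicity ns =
    (if ns Y1 = ns Z1 then if ns Z1 = 0 then 1 else 2
     else if \<bar>int (ns Y1) - int (ns Z1)\<bar> = 1 then 1 else 0)"

lemma quot_basis_M11:
  obtains B :: "'f::field_char_0 free_algebra set"
  where "is_quot_basis pm_scale (multilinear ns) (multilinear ns \<inter> Id_star M11) B"
    "card B = row_multiplicity ns"
proof -
  let ?b = "\<lambda>ks. kinds_word (even_kinds ns @ ks) :: 'f free_algebra"
  have mult: "?b ks \<in> multilinear ns"
    if "count_list ks Y0 = 0" "count_list ks Z0 = 0" "count_list ks Y1 = ns Y1" "count_list ks Z1 = ns Z1"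
    for ks
  proof (rule kinds_word_multilinear)
    fix s show "count_list (even_kinds ns @ ks) s = ns s"
      using that by (cases s) (auto simp: even_kinds_def count_list_replicate)
  qed
  have eval: "eval_units (?b ks) $ i $ j = (if i = 1 then 1 else (-1) ^ ns Z0) * kinds_prod ks $ i $ j"
    for ks i j
    by (simp add: eval_units_kinds_word kinds_prod_even_kinds)
  have zero: "eval_units f $ i $ j = 0"
    if "f \<in> multilinear ns" "int (ns Z1) - int (ns Y1) \<noteq> (if j = 2 then 1 else 0) - (if i = 2 then 1 else 0)"
    for i j and f :: "'f free_algebra"
    using eval_units_nth_nonzero[OF that(1)] that(2) by blast
  consider (even) "ns Y1 = 0" "ns Z1 = 0" | (eq) "ns Y1 = ns Z1" "0 < ns Z1"
    | (Y) "ns Y1 = Suc (ns Z1)" | (Z) "ns Z1 = Suc (ns Y1)"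
    | (far) "\<bar>int (ns Y1) - int (ns Z1)\<bar> > 1"
    by linarith
  then show ?thesis
  proof cases
    case even
    \<comment> \<open>All values lie on the line of the diagonal matrix with entries 1 and
      \<open>(-1) ^ ns Z0\<close>, which one even word spans.\<close>
    let ?x = "?b []"
    have x: "?x \<in> multilinear ns" using even by (intro mult) auto
    have e: "eval_units ?x $ 1 $ 1 = 1" "eval_units ?x $ 2 $ 2 = (-1) ^ ns Z0"
      unfolding eval by (simp_all add: kinds_prod_def mat_def)
    have "is_quot_basis pm_scale (multilinear ns) (multilinear ns \<inter> Id_star M11) {?x}"
    proof (rule quot_basis_M11_singleton[OF x])
      show "eval_units ?x \<noteq> 0" using e(1) by (metis zero_index zero_neq_one)
      fix f :: "'f free_algebra" assume f: "f \<in> multilinear ns"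
      show "\<exists>c. eval_units f = smult M11 c (eval_units ?x)"
        using zero[OF f, of 1 2] zero[OF f, of 2 1] zero[OF x, of 1 2] zero[OF x, of 2 1] even
          eval_units_even_only[OF f even] e
        by (intro exI[of _ "eval_units f $ 1 $ 1"] M11_eqI) (auto simp: mult.commute)
    qed
    then show ?thesis by (rule that) (simp add: even row_multiplicity_def)
  next
    case eq
    \<comment> \<open>The two alternating orders of the odd letters reach the two diagonal
      positions: \<open>?x\<close> gives e_22 up to the sign \<open>?s\<close> of the even prefix,
      and \<open>?y\<close> gives e_11.\<close>
    let ?x = "?b (concat (replicate (ns Z1) [Y1, Z1]))" and ?y = "?b (concat (replicate (ns Z1) [Z1, Y1]))"
    let ?s = "(-1) ^ ns Z0 :: 'f"
    have x: "?x \<in> multilinear ns" and y: "?y \<in> multilinear ns"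
      using eq by (auto intro!: mult simp: count_list_concat_replicate)
    have e: "eval_units ?x $ 1 $ 1 = 0" "eval_units ?x $ 2 $ 2 = ?s"
      "eval_units ?y $ 1 $ 1 = 1" "eval_units ?y $ 2 $ 2 = 0"
      unfolding eval using eq by (simp_all add: kinds_prod_alternating)
    then have "?x \<noteq> ?y" by force
    have "is_quot_basis pm_scale (multilinear ns) (multilinear ns \<inter> Id_star M11) {?x, ?y}"
    proof (rule is_quot_basis_M11I)
      fix f :: "'f free_algebra" assume f: "f \<in> multilinear ns"
      \<comment> \<open>The sign \<open>?s\<close> is its own inverse, so this factor cancels the
        sign in the value of \<open>?x\<close>.\<close>
      let ?c = "\<lambda>b. if b = ?x then ?s * eval_units f $ 2 $ 2 else eval_units f $ 1 $ 1"
      show "\<exists>c. eval_units f = (\<Sum>b\<in>{?x, ?y}. smult M11 (c b) (eval_units b))"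
        using zero[OF f, of 1 2] zero[OF f, of 2 1] zero[OF x, of 1 2] zero[OF x, of 2 1]
          zero[OF y, of 1 2] zero[OF y, of 2 1] eq e \<open>?x \<noteq> ?y\<close>
        by (intro exI[of _ ?c] M11_eqI) (auto simp: power_mult_distrib[symmetric] simp flip: power_add mult_2)
    next
      fix c b assume 0: "(\<Sum>b\<in>{?x, ?y}. smult M11 (c b) (eval_units b)) = 0" and b: "b \<in> {?x, ?y}"
      have "(\<Sum>b\<in>{?x, ?y}. smult M11 (c b) (eval_units b)) $ i $ i = 0" for i
        by (simp only: 0 zero_index)
      from this[of 1] this[of 2] have "c ?x = 0" "c ?y = 0"
        using \<open>?x \<noteq> ?y\<close> e by auto
      then show "c b = 0" using b by auto
    qed (use x y in auto)
    then show ?thesis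
      by (rule that) (use eq \<open>?x \<noteq> ?y\<close> in \<open>simp add: row_multiplicity_def\<close>)
  next
    case Y
    \<comment> \<open>The surplus \<open>Y1\<close> in front gives e_21 up to the sign of the even
      prefix; no other position can be nonzero.\<close>
    let ?x = "?b (Y1 # concat (replicate (ns Z1) [Z1, Y1]))"
    have x: "?x \<in> multilinear ns" using Y by (intro mult) (auto simp: count_list_concat_replicate)
    have e: "eval_units ?x $ 2 $ 1 = (-1) ^ ns Z0"
      unfolding eval by (simp add: kinds_prod_Cons matrix_matrix_mult_def sum_2 vector_2 kinds_prod_alternating)
    have z: "eval_units f $ 1 $ 2 = 0" if "f \<in> multilinear ns" for f :: "'f free_algebra"
      by (rule zero[OF that]) (simp add: Y)
    have "is_quot_basis pm_scale (multilinear ns) (multilinear ns \<inter> Id_star M11) {?x}"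
    proof (rule quot_basis_M11_singleton[OF x])
      show "eval_units ?x \<noteq> 0" using e by auto
      fix f :: "'f free_algebra" assume f: "f \<in> multilinear ns"
      show "\<exists>c. eval_units f = smult M11 c (eval_units ?x)"
        using zero[OF f, of 1 1] zero[OF f, of 2 2] z[OF f]
          zero[OF x, of 1 1] zero[OF x, of 2 2] z[OF x] Y e
        by (intro exI[of _ "eval_units f $ 2 $ 1 / (-1) ^ ns Z0"] M11_eqI) auto
    qed
    then show ?thesis by (rule that) (simp add: Y row_multiplicity_def)
  next
    case Z
    \<comment> \<open>The surplus \<open>Z1\<close> in front gives e_12; the even prefix acts on the
      first row by 1, so no sign appears.\<close>
    let ?x = "?b (Z1 # concat (replicate (ns Y1) [Y1, Z1]))"
    have x: "?x \<in> multilinear ns" using Z by (intro mult) (auto simp: count_list_concat_replicate)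
    have e: "eval_units ?x $ 1 $ 2 = 1"
      unfolding eval by (simp add: kinds_prod_Cons matrix_matrix_mult_def sum_2 vector_2 kinds_prod_alternating)
    have z: "eval_units f $ 2 $ 1 = 0" if "f \<in> multilinear ns" for f :: "'f free_algebra"
      by (rule zero[OF that]) (simp add: Z)
    have "is_quot_basis pm_scale (multilinear ns) (multilinear ns \<inter> Id_star M11) {?x}"
    proof (rule quot_basis_M11_singleton[OF x])
      show "eval_units ?x \<noteq> 0" using e by auto
      fix f :: "'f free_algebra" assume f: "f \<in> multilinear ns"
      show "\<exists>c. eval_units f = smult M11 c (eval_units ?x)"
        using zero[OF f, of 1 1] zero[OF f, of 2 2] z[OF f]
          zero[OF x, of 1 1] zero[OF x, of 2 2] z[OF x] Z e
        by (intro exI[of _ "eval_units f $ 1 $ 2"] M11_eqI) auto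
    qed
    then show ?thesis by (rule that) (simp add: Z row_multiplicity_def)
  next
    case far
    have "is_quot_basis pm_scale (multilinear ns) (multilinear ns \<inter> Id_star (M11 :: ('f, _) superinv_algebra)) {}"
    proof (rule is_quot_basis_M11I)
      fix f :: "'f free_algebra" assume f: "f \<in> multilinear ns"
      \<comment> \<open>Only the differences -1, 0 and 1 belong to a matrix position, so all values
        are zero and the empty set is a basis.\<close>
      have "eval_units f $ i $ j = 0" for i j
        using far by (intro zero[OF f]) auto
      then show "\<exists>c. eval_units f = (\<Sum>b\<in>{}. smult M11 (c b) (eval_units b))"
        by (simp add: vec_eq_iff)
    qed auto
    then show ?thesis by (rule that) (use far in \<open>auto simp: row_multiplicity_def\<close>)
  qed
qed

lemma cocharacter_M11:
  assumes "\<sigma> \<in> sym_groups ns"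
  shows "cocharacter (M11 :: ('f::field_char_0, _) superinv_algebra) ns \<sigma> = of_nat (row_multiplicity ns)"
proof -
  obtain B :: "'f free_algebra set"
    where B: "is_quot_basis pm_scale (multilinear ns) (multilinear ns \<inter> Id_star M11) B"
      "card B = row_multiplicity ns"
    by (rule quot_basis_M11)
  have "var_action \<sigma> f - f \<in> multilinear ns \<inter> Id_star M11"
    if f: "f \<in> multilinear ns" for f :: "'f free_algebra"
  proof -
    have V: "var_action \<sigma> f - f \<in> multilinear ns"
      using f assms by (intro pm.subspace_diff subspace_multilinear var_action_multilinear)
    then show ?thesis
      using Id_star_M11_iff[OF V] by (simp add: eu.diff eval_units_var_action)
  qed
  then show ?thesis
    unfolding cocharacter_def B(2)[symmetric]
    by (intro pm.quot_trace_trivial_action[OF B(1)] subspace_multilinear subspace_multilinear_Id) auto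
qed

section \<open>Multiplicities\<close>

text \<open>In this form a sum over the group of a product over the kinds factors by
  \<open>prod_sum_PiE\<close>.\<close>

lemma sym_groups_PiE: "sym_groups ns = (\<Pi>\<^sub>E s\<in>UNIV. {p. p permutes {1..ns s}})"
  by (auto simp: sym_groups_def PiE_def)

lemma finite_sym_groups: "finite (sym_groups ns)"
  by (simp add: sym_groups_PiE finite_PiE finite_permutations)

lemma id_in_sym_groups: "(\<lambda>_. id) \<in> sym_groups ns"
  by (simp add: sym_groups_def permutes_id)

text \<open>Parts are positive, so the shape of size 0 is the empty list; having at most one row
  thus means length at most 1.\<close>

definition row_shape :: "nat \<Rightarrow> nat list" where
  "row_shape k = (if k = 0 then [] else [k])"

lemma partition_of_row_shape: "partition_of k (row_shape k)"
  by (simp add: partition_of_def row_shape_def)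

lemma partition_of_row:
  assumes "partition_of k \<mu>" "length \<mu> \<le> 1"
  shows "\<mu> = row_shape k"
  using assms by (cases \<mu>) (auto simp: partition_of_def row_shape_def)

lemma irr_multichar_row:
  assumes "\<sigma> \<in> sym_groups ns"
  shows "irr_multichar (\<lambda>s. row_shape (ns s)) \<sigma> = (1 :: 'f::field)"
  unfolding irr_multichar_def
proof (rule prod.neutral, safe)
  fix s
  have "sum_list (row_shape (ns s)) = ns s" "length (row_shape (ns s)) \<le> 1"
    by (auto simp: row_shape_def)
  then show "irr_char (row_shape (ns s)) (\<sigma> s) = (1 :: 'f)"
    using assms by (intro irr_char_row) (simp_all add: sym_groups_def)
qed

text \<open>The sum factors into one sum per kind. A partition other than the row shape has at least
  two rows, so the factor of that kind is 0.\<close>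

lemma sum_irr_multichar:
  assumes "\<Lambda> \<in> multipartitions ns" "\<Lambda> \<noteq> (\<lambda>s. row_shape (ns s))"
  shows "(\<Sum>\<sigma>\<in>sym_groups ns. irr_multichar \<Lambda> \<sigma>) = (0 :: 'f::field)"
proof -
  obtain s where s: "\<Lambda> s \<noteq> row_shape (ns s)" using assms(2) by blast
  have part: "partition_of (ns s) (\<Lambda> s)" using assms(1) by (simp add: multipartitions_def)
  have "(\<Sum>\<sigma>\<in>sym_groups ns. irr_multichar \<Lambda> \<sigma>) =
      (\<Prod>s\<in>UNIV. \<Sum>p | p permutes {1..ns s}. irr_char (\<Lambda> s) p :: 'f)"
    unfolding irr_multichar_def sym_groups_PiE
    by (rule prod_sum_PiE[symmetric]) (simp_all add: finite_permutations)
  also have "\<dots> = 0"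
    using sum_irr_char_nonrow[OF part] partition_of_row[OF part] s by (intro prod_zero) auto
  finally show ?thesis .
qed

lemma irr_multichar_id: "\<exists>d>0. irr_multichar \<Lambda> (\<lambda>_. id) = (of_nat d :: 'f::field)"
proof -
  have "\<exists>d>0. irr_char (\<Lambda> s) id = (of_nat d :: 'f)" for s
    by (metis irr_char_id)
  then obtain d where d: "\<And>s. 0 < d s" "\<And>s. irr_char (\<Lambda> s) id = (of_nat (d s) :: 'f)"
    by metis
  then show ?thesis
    by (intro exI[of _ "\<Prod>s\<in>UNIV. d s"]) (simp add: irr_multichar_def prod_pos)
qed

section \<open>Existence and uniqueness of the decomposition\<close>

lemma cocharacter_decomposition_M11_exists:
  "is_cocharacter_decomposition (M11 :: ('f::field_char_0, _) superinv_algebra) ns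
    (\<lambda>\<Lambda>. if \<Lambda> = (\<lambda>s. row_shape (ns s)) then row_multiplicity ns else 0)"
proof -
  let ?R = "\<lambda>s. row_shape (ns s)"
  have R: "?R \<in> multipartitions ns"
    by (simp add: multipartitions_def partition_of_row_shape)
  \<comment> \<open>Only \<open>?R\<close> contributes; its character is constantly 1, matching the
    constant cocharacter.\<close>
  have "(\<Sum>\<Lambda>\<in>multipartitions ns. of_nat (if \<Lambda> = ?R then row_multiplicity ns else 0) * irr_multichar \<Lambda> \<sigma>) =
      (\<Sum>\<Lambda>\<in>multipartitions ns. if \<Lambda> = ?R then of_nat (row_multiplicity ns) * irr_multichar ?R \<sigma> else 0 :: 'f)" for \<sigma>
    by (intro sum.cong) auto
  then show ?thesis
    using R by (simp add: is_cocharacter_decomposition_def cocharacter_M11 irr_multichar_row finite_multipartitions)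
qed

lemma cocharacter_decomposition_M11_unique:
  assumes m: "is_cocharacter_decomposition (M11 :: ('f::field_char_0, _) superinv_algebra) ns m"
    and \<Lambda>: "\<Lambda> \<in> multipartitions ns"
  shows "m \<Lambda> = (if \<Lambda> = (\<lambda>s. row_shape (ns s)) then row_multiplicity ns else 0)"
proof -
  let ?R = "\<lambda>s. row_shape (ns s)" and ?G = "sym_groups ns" and ?P = "multipartitions ns"
  let ?\<chi> = "irr_multichar :: _ \<Rightarrow> _ \<Rightarrow> 'f"
  have R: "?R \<in> ?P"
    by (simp add: multipartitions_def partition_of_row_shape)
  have eq: "of_nat (row_multiplicity ns) = (\<Sum>\<Lambda>\<in>?P. of_nat (m \<Lambda>) * ?\<chi> \<Lambda> \<sigma>)" if "\<sigma> \<in> ?G" for \<sigma>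
    using m that cocharacter_M11[OF that, where 'f='f] unfolding is_cocharacter_decomposition_def by metis
  \<comment> \<open>Summing over the group isolates \<open>?R\<close>, since every other character
    sums to 0.\<close>
  have "of_nat (card ?G) * of_nat (row_multiplicity ns) = (\<Sum>\<sigma>\<in>?G. \<Sum>\<Lambda>\<in>?P. of_nat (m \<Lambda>) * ?\<chi> \<Lambda> \<sigma>)"
    by (simp add: eq[symmetric])
  also have "\<dots> = (\<Sum>\<Lambda>\<in>?P. of_nat (m \<Lambda>) * (\<Sum>\<sigma>\<in>?G. ?\<chi> \<Lambda> \<sigma>))"
    by (subst sum.swap) (simp add: sum_distrib_left)
  also have "\<dots> = (\<Sum>\<Lambda>\<in>?P. if \<Lambda> = ?R then of_nat (m ?R) * of_nat (card ?G) else 0)"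
    by (intro sum.cong) (auto simp: sum_irr_multichar irr_multichar_row)
  also have "\<dots> = of_nat (card ?G) * of_nat (m ?R)"
    using R by (simp add: finite_multipartitions mult.commute)
  \<comment> \<open>Characteristic zero brings the equation down to the naturals, where the nonzero
    group order cancels.\<close>
  finally have "card ?G = 0 \<or> row_multiplicity ns = m ?R"
    by simp
  then have mR: "m ?R = row_multiplicity ns"
    using finite_sym_groups id_in_sym_groups by (metis card_0_eq empty_iff)
  obtain d where d: "\<And>\<Lambda>. 0 < d \<Lambda>" "\<And>\<Lambda>. ?\<chi> \<Lambda> (\<lambda>_. id) = of_nat (d \<Lambda>)"
    using irr_multichar_id by metis
  have "(of_nat (row_multiplicity ns) :: 'f) = of_nat (\<Sum>\<Lambda>\<in>?P. m \<Lambda> * d \<Lambda>)"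
    using eq[OF id_in_sym_groups] by (simp add: d(2))
  then have "m ?R = (\<Sum>\<Lambda>\<in>?P. m \<Lambda> * d \<Lambda>)"
    unfolding mR of_nat_eq_iff .
  also have "\<dots> = m ?R * d ?R + (\<Sum>\<Lambda>\<in>?P - {?R}. m \<Lambda> * d \<Lambda>)"
    using R finite_multipartitions by (rule sum.remove[rotated])
  \<comment> \<open>The left-hand side equals \<open>m ?R\<close>, and the degree
    \<open>d ?R\<close> is at least 1; so nothing is left for the remaining sum.\<close>
  finally have "m ?R * d ?R + (\<Sum>\<Lambda>\<in>?P - {?R}. m \<Lambda> * d \<Lambda>) \<le> m ?R * d ?R"
    using d(1)[of ?R] by (metis le_square mult_le_mono2 nat_mult_1_right Suc_leI One_nat_def)
  then have "(\<Sum>\<Lambda>\<in>?P - {?R}. m \<Lambda> * d \<Lambda>) = 0" by simp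
  then have "m \<Lambda> * d \<Lambda> = 0" if "\<Lambda> \<noteq> ?R"
    using that \<Lambda> finite_multipartitions[of ns] by simp
  then show ?thesis using mR d(1)[of \<Lambda>] by auto
qed

theorem theorem4p5:
  fixes n :: nat and ns :: "vkind \<Rightarrow> nat"
  assumes "n \<ge> 1"
    and "(\<Sum>s\<in>UNIV. ns s) = n"
  shows "(\<exists>m. is_cocharacter_decomposition
            (M11 :: ('f::field_char_0, 'f^2^2) superinv_algebra) ns m) \<and>
    (\<forall>m. is_cocharacter_decomposition
            (M11 :: ('f::field_char_0, 'f^2^2) superinv_algebra) ns m \<longrightarrow>
      (\<forall>\<Lambda>\<in>multipartitions ns.
        ((\<forall>s. length (\<Lambda> s) \<le> 1) \<longrightarrow>
           (ns Y1 = ns Z1 \<and> ns Z1 > 0 \<longrightarrow> m \<Lambda> = 2) \<and>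
           (\<bar>int (ns Y1) - int (ns Z1)\<bar> = 1 \<or> (ns Y1 = 0 \<and> ns Z1 = 0) \<longrightarrow> m \<Lambda> = 1) \<and>
           (\<bar>int (ns Y1) - int (ns Z1)\<bar> > 1 \<longrightarrow> m \<Lambda> = 0)) \<and>
        (\<not> (\<forall>s. length (\<Lambda> s) \<le> 1) \<longrightarrow> m \<Lambda> = 0)))"
proof (intro conjI allI impI ballI)
  show "\<exists>m. is_cocharacter_decomposition (M11 :: ('f, 'f^2^2) superinv_algebra) ns m"
    using cocharacter_decomposition_M11_exists by blast
next
  fix m \<Lambda>
  assume m: "is_cocharacter_decomposition (M11 :: ('f, 'f^2^2) superinv_algebra) ns m"
    and \<Lambda>: "\<Lambda> \<in> multipartitions ns"
  note unique = cocharacter_decomposition_M11_unique[OF m \<Lambda>]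
  have len: "length (row_shape k) \<le> 1" for k by (simp add: row_shape_def)
  show "m \<Lambda> = 0" if "\<not> (\<forall>s. length (\<Lambda> s) \<le> 1)"
    using unique that len by auto
  assume "\<forall>s. length (\<Lambda> s) \<le> 1"
  then have "\<Lambda> = (\<lambda>s. row_shape (ns s))"
    using \<Lambda> partition_of_row by (auto simp: multipartitions_def)
  then have mult: "m \<Lambda> = row_multiplicity ns" using unique by simp
  show "m \<Lambda> = 2" if "ns Y1 = ns Z1 \<and> ns Z1 > 0"
    using that by (simp add: mult row_multiplicity_def)
  show "m \<Lambda> = 1" if "\<bar>int (ns Y1) - int (ns Z1)\<bar> = 1 \<or> (ns Y1 = 0 \<and> ns Z1 = 0)"
    using that by (auto simp: mult row_multiplicity_def)
  show "m \<Lambda> = 0" if "\<bar>int (ns Y1) - int (ns Z1)\<bar> > 1"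
    using that by (auto simp: mult row_multiplicity_def)
qed

end
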